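(* Let $G=(V,E)$ be a simple directed graph with $n=|V|$ vertices and independent edge propagation probabilities $p_e\in[0,1]$ ($e\in E$), given with a tree decomposition of width $w$ with $O(n)$ bags and a seed budget $K$. The algorithm Exact Greedy (described in the context) computes exactly the same seed set as classical greedy influence maximization using exact marginal gains, in $$O\!\left(K\,n\,2^{O(w^2)}\operatorname{poly}(w)\right)$$ time.
   Context: Independent Cascade model, live-edge form: each edge $e\in E$ is independently live with probability $p_e$ and dead otherwise. A vertex is activated by a seed set $S\subseteq V$ if and only if it is reachable from $S$ by a directed path (possibly of length zero) of live edges. $\sigma(S)$ is the expected number of vertices activated by $S$. Classical greedy influence maximization with budget $K$: start with $S=\emptyset$ and, $K$ times, add to $S$ a vertex $v\notin S$ of maximum marginal gain $\Delta(v\mid S)=\sigma(S\cup\{v\})-\sigma(S)$. A tree decomposition of a directed graph means one of its underlying undirected graph: a tree $\mathcal T$ with bags $B_x\subseteq V$ such that every vertex lies in some bag, every edge has both endpoints in some bag, and the bags containing any fixed vertex form a connected subtree. Its width is $\max_x|B_x|-1$. The function $F$: add a new vertex $\rho\notin V$ and, for every $v\in V$, an artificial edge $\rho\to v$. Original edges are live with probability $p_e$ and artificial edges $\rho\to v$ with probability $\theta_v\in[0,1]$, all independently. Then $F(\boldsymbol\theta)=\sum_{u\in V}\mathbb P_{\boldsymbol\theta}(\rho\rightsquigarrow u)$, where $\rho\rightsquigarrow u$ means there is a directed path of live edges from $\rho$ to $u$. $\mathbf 1_S$ is the indicator vector of $S$. Algorithm Exact Greedy. Preprocessing: add $\rho$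 to every bag, giving $B_x^+=B_x\cup\{\rho\}$; assign every original and artificial edge to exactly one owning bag containing both its endpoints; compile the possible reachability relations (states) on bags and on separators $C_{xy}^+=B_x^+\cap B_y^+$, together with the maps that combine relations by taking the transitive closure of their union and restricting it to a separator or bag. Set $S=\emptyset$. Then repeat $K$ times: (1) set $\boldsymbol\theta=\mathbf 1_S$; (2) for each bag $x$ compute the probability distribution of the reachability relation induced on $B_x^+$ by the live edges owned by $x$; (3) by one upward (leaves to root) and one downward (root to leaves) sweep over $\mathcal T$, compute for every directed tree edge $x\to y$ the message $M_{x\to y}$, i.e. the distribution of the reachability relation induced on $C_{xy}^+$ by the edges owned by bags on the $x$-side of the tree edge; $M_{x\to y}(R)$ is the sum, over all tuples consisting of a local relation at $x$ and one relation from each neighbor $z\ne y$ of $x$ whose combination is $R$, of the product of the local probability and the probabilities $M_{z\to x}$; (4) at each bag combine the local distribution with all incoming messages in the same way to obtain the distribution of the global reachability relation on $B_x^+$, read off $\mathbb P_{\boldsymbol\theta}(\rho\rightsquigarrow v)$ for every $v\in V$ from a bag containing $v$, and evaluate $F(\boldsymbol\theta)$; (5) reverse this arithmetic computation (reverse-mode differentiation: one backward pass through the circuit of additions and multiplications) to obtain $g_v=\frac{\partial F}{\partial\theta_v}(\mathbf 1_S)$ for all $v\in V$; (6) select $v^\star\in\arg\max_{v\notin S}g_v$ and replace $S$ by $S\cup\{v^\star\}$. Finally return $S$. Time is measured as the number of arithmetic operations. *)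

theory Defs
  imports
    "HOL-Probability.Probability"
    "HOL-Computational_Algebra.Polynomial"
    "HOL-Library.State_Monad"
    "HOL-Library.AList"
    "Graph_Theory.Pair_Digraph"
begin

section \<open>Independent cascades and greedy seed selection\<close>

definition live_edges :: "'a rel \<Rightarrow> ('a \<times> 'a \<Rightarrow> real) \<Rightarrow> ('a \<times> 'a \<Rightarrow> bool) pmf" where
  "live_edges E p = Pi_pmf E False (\<lambda>e. bernoulli_pmf (p e))"

definition activated :: "'a pair_pre_digraph \<Rightarrow> 'a set \<Rightarrow> ('a \<times> 'a \<Rightarrow> bool) \<Rightarrow> 'a set" where
  "activated G S \<omega> = {u \<in> pverts G. \<exists>s\<in>S. (s, u) \<in> {e \<in> parcs G. \<omega> e}\<^sup>*}"

definition influence :: "'a pair_pre_digraph \<Rightarrow> ('a \<times> 'a \<Rightarrow> real) \<Rightarrow> 'a set \<Rightarrow> real" where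
  "influence G p S =
     measure_pmf.expectation (live_edges (parcs G) p) (\<lambda>\<omega>. real (card (activated G S \<omega>)))"

definition marginal_gain ::
    "'a pair_pre_digraph \<Rightarrow> ('a \<times> 'a \<Rightarrow> real) \<Rightarrow> 'a \<Rightarrow> 'a set \<Rightarrow> real" where
  "marginal_gain G p v S = influence G p (S \<union> {v}) - influence G p S"

text \<open>
  The argument \<open>tie\<close> is a tie-breaking rule: \<open>tie S A\<close> is the vertex selected when \<open>S\<close> is the current
  seed set and \<open>A\<close> is the set of all maximizers.
\<close>

definition select ::
    "('a set \<Rightarrow> 'a set \<Rightarrow> 'a) \<Rightarrow> 'a pair_pre_digraph \<Rightarrow> 'a set \<Rightarrow> ('a \<Rightarrow> real) \<Rightarrow> 'a" where
  "select tie G S score = tie S {v. is_arg_max score (\<lambda>v. v \<in> pverts G - S) v}"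

definition classical_greedy ::
    "('a set \<Rightarrow> 'a set \<Rightarrow> 'a) \<Rightarrow> 'a pair_pre_digraph \<Rightarrow> ('a \<times> 'a \<Rightarrow> real) \<Rightarrow> nat \<Rightarrow> 'a set" where
  "classical_greedy tie G p K =
     ((\<lambda>S. S \<union> {select tie G S (\<lambda>v. marginal_gain G p v S)}) ^^ K) {}"


section \<open>Tree decompositions\<close>

text \<open>
  The decomposition tree comes with a root and an order of the children of each node, as needed for
  the sweeps. Nodes are named; \<open>tree_decomposition\<close> requires the names to be distinct, so that
  \<open>nodes t\<close> and the symmetric closure of \<open>tree_arcs t\<close> form a tree in the graph-theoretic sense.
  Both lists are in preorder.
\<close>

datatype 'b rtree = Node 'b "'b rtree list"

primrec root_of :: "'b rtree \<Rightarrow> 'b" where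
  "root_of (Node x ts) = x"

primrec nodes :: "'b rtree \<Rightarrow> 'b list" where
  "nodes (Node x ts) = x # concat (map nodes ts)"

fun tree_arcs :: "'b rtree \<Rightarrow> ('b \<times> 'b) list" where
  "tree_arcs (Node x ts) = concat (map (\<lambda>t. (x, root_of t) # tree_arcs t) ts)"

definition children :: "'b rtree \<Rightarrow> 'b \<Rightarrow> 'b list" where
  "children t x = map snd (filter (\<lambda>(y, z). y = x) (tree_arcs t))"

definition parents :: "'b rtree \<Rightarrow> 'b \<Rightarrow> 'b list" where
  "parents t x = map fst (filter (\<lambda>(y, z). z = x) (tree_arcs t))"

definition connected_in :: "'b rtree \<Rightarrow> 'b set \<Rightarrow> bool" where
  "connected_in t X \<longleftrightarrow>
     (\<forall>x\<in>X. \<forall>y\<in>X. (x, y) \<in> ((set (tree_arcs t) \<union> (set (tree_arcs t))\<inverse>) \<inter> X \<times> X)\<^sup>*)"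

definition tree_decomposition ::
    "'a pair_pre_digraph \<Rightarrow> 'b rtree \<Rightarrow> ('b \<Rightarrow> 'a set) \<Rightarrow> bool" where
  "tree_decomposition G t B \<longleftrightarrow>
     distinct (nodes t) \<and>
     (\<forall>x\<in>set (nodes t). B x \<subseteq> pverts G) \<and>
     (\<forall>v\<in>pverts G. \<exists>x\<in>set (nodes t). v \<in> B x) \<and>
     (\<forall>(u, v)\<in>parcs G. \<exists>x\<in>set (nodes t). u \<in> B x \<and> v \<in> B x) \<and>
     (\<forall>v\<in>pverts G. connected_in t {x \<in> set (nodes t). v \<in> B x})"

definition width :: "'b rtree \<Rightarrow> ('b \<Rightarrow> 'a set) \<Rightarrow> nat" where
  "width t B = Max ((\<lambda>x. card (B x)) ` set (nodes t)) - 1"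


section \<open>The extended graph\<close>

text \<open>The new vertex \<open>\<rho>\<close> is \<open>None\<close>; an original vertex \<open>v\<close> is \<open>Some v\<close>.\<close>

definition artificial_edges :: "'a pair_pre_digraph \<Rightarrow> 'a option rel" where
  "artificial_edges G = {(None, Some v) | v. v \<in> pverts G}"

definition extended_edges :: "'a pair_pre_digraph \<Rightarrow> 'a option rel" where
  "extended_edges G = map_prod Some Some ` parcs G \<union> artificial_edges G"

definition ext_bag :: "('b \<Rightarrow> 'a set) \<Rightarrow> 'b \<Rightarrow> 'a option set" where
  "ext_bag B x = Some ` B x \<union> {None}"

definition owner_assignment ::
    "'a pair_pre_digraph \<Rightarrow> 'b rtree \<Rightarrow> ('b \<Rightarrow> 'a set) \<Rightarrow> ('a option \<times> 'a option \<Rightarrow> 'b) \<Rightarrow> bool" where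
  "owner_assignment G t B own \<longleftrightarrow>
     (\<forall>(u, v)\<in>extended_edges G.
        own (u, v) \<in> set (nodes t) \<and> u \<in> ext_bag B (own (u, v)) \<and> v \<in> ext_bag B (own (u, v)))"

definition readout_assignment ::
    "'a pair_pre_digraph \<Rightarrow> 'b rtree \<Rightarrow> ('b \<Rightarrow> 'a set) \<Rightarrow> ('a \<Rightarrow> 'b) \<Rightarrow> bool" where
  "readout_assignment G t B rd \<longleftrightarrow> (\<forall>v\<in>pverts G. rd v \<in> set (nodes t) \<and> v \<in> B (rd v))"

definition reach_rel :: "'v set \<Rightarrow> 'v rel \<Rightarrow> 'v rel" where
  "reach_rel Y L = L\<^sup>* \<inter> Y \<times> Y"


section \<open>Arithmetic circuits\<close>

text \<open>
  The operands of a gate are positions of earlier gates. \<open>Inp v\<close> reads \<open>\<theta>\<^sub>v\<close>. The passes below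
  return the number of real additions and multiplications that they carry out.
\<close>

datatype 'a gate = Con real | Inp 'a | Add nat nat | Mul nat nat

fun forward_step :: "('a \<Rightarrow> real) \<Rightarrow> 'a gate \<Rightarrow> real list \<times> nat \<Rightarrow> real list \<times> nat" where
  "forward_step \<theta> (Con r) (vs, k) = (vs @ [r], k)"
| "forward_step \<theta> (Inp v) (vs, k) = (vs @ [\<theta> v], k)"
| "forward_step \<theta> (Add i j) (vs, k) = (vs @ [vs ! i + vs ! j], k + 1)"
| "forward_step \<theta> (Mul i j) (vs, k) = (vs @ [vs ! i * vs ! j], k + 1)"

definition forward :: "'a gate list \<Rightarrow> ('a \<Rightarrow> real) \<Rightarrow> real list \<times> nat" where
  "forward c \<theta> = fold (forward_step \<theta>) c ([], 0)"

text \<open>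
  Reverse mode: \<open>a m\<close> accumulates the adjoint of gate \<open>m\<close>, and \<open>g v\<close> the derivative with respect to
  \<open>\<theta>\<^sub>v\<close>. The updates are sequential because both operands may be the same gate.
\<close>

fun backward_step ::
    "real list \<Rightarrow> nat \<times> 'a gate \<Rightarrow> (nat \<Rightarrow> real) \<times> ('a \<Rightarrow> real) \<times> nat
       \<Rightarrow> (nat \<Rightarrow> real) \<times> ('a \<Rightarrow> real) \<times> nat" where
  "backward_step vs (m, Con r) (a, g, k) = (a, g, k)"
| "backward_step vs (m, Inp v) (a, g, k) = (a, g(v := g v + a m), k + 1)"
| "backward_step vs (m, Add i j) (a, g, k) =
     (let a' = a(i := a i + a m); a'' = a'(j := a' j + a m) in (a'', g, k + 2))"
| "backward_step vs (m, Mul i j) (a, g, k) =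
     (let a' = a(i := a i + a m * vs ! j); a'' = a'(j := a' j + a m * vs ! i) in (a'', g, k + 4))"

definition backward :: "'a gate list \<Rightarrow> nat \<Rightarrow> real list \<Rightarrow> ('a \<Rightarrow> real) \<times> nat" where
  "backward c out vs =
     snd (foldr (backward_step vs) (List.enumerate 0 c) ((\<lambda>_. 0)(out := 1), \<lambda>_. 0, 0))"


section \<open>Compilation\<close>

text \<open>
  Preprocessing performs no real arithmetic: it determines the states (relations), how they combine,
  and thereby the circuit that is evaluated in every round. Its state consists of the gates emitted
  so far and a counter of elementary operations on relations.
\<close>

type_synonym ('a, 'r) compiler = "('a gate list \<times> nat, 'r) state"

text \<open>
  A distribution over relations lists the states occurring in it, without repetition, each with the
  gate computing its probability.
\<close>

type_synonym 'a dist = "('a option rel \<times> nat) list"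

definition emit :: "'a gate \<Rightarrow> ('a, nat) compiler" where
  "emit g = State (\<lambda>(c, k). (length c, (c @ [g], k)))"

definition charge :: "nat \<Rightarrow> ('a, unit) compiler" where
  "charge m = State (\<lambda>(c, k). ((), (c, k + m)))"

primrec foldM :: "('x \<Rightarrow> 'r \<Rightarrow> ('s, 'r) state) \<Rightarrow> 'x list \<Rightarrow> 'r \<Rightarrow> ('s, 'r) state" where
  "foldM f [] r = State_Monad.return r"
| "foldM f (x # xs) r = do {r' \<leftarrow> f x r; foldM f xs r'}"

text \<open>The elements of a finite set in some order.\<close>

definition enum :: "'x set \<Rightarrow> 'x list" where
  "enum A = (SOME xs. distinct xs \<and> set xs = A)"

definition accumulate :: "'a option rel \<Rightarrow> nat \<Rightarrow> 'a dist \<Rightarrow> ('a, 'a dist) compiler" where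
  "accumulate R i D =
     (case map_of D R of
        None \<Rightarrow> State_Monad.return (D @ [(R, i)])
      | Some j \<Rightarrow> do {k \<leftarrow> emit (Add j i); State_Monad.return (AList.update R k D)})"

text \<open>
  The distribution of the transitive closure of the union of two independent relations, restricted
  to \<open>Y\<close>. The relations live on \<open>X\<close>; each combination is charged with the \<open>|X|\<^sup>3\<close> Boolean operations
  of Warshall's algorithm.
\<close>

definition combine ::
    "'a option set \<Rightarrow> 'a option set \<Rightarrow> 'a dist \<Rightarrow> 'a dist \<Rightarrow> ('a, 'a dist) compiler" where
  "combine X Y D1 D2 =
     foldM (\<lambda>((R1, i), (R2, j)) D. do {
        charge (card X ^ 3);
        k \<leftarrow> emit (Mul i j);
        accumulate (reach_rel Y (R1 \<union> R2)) k D
      }) (List.product D1 D2) []"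

definition unit_dist :: "'a option set \<Rightarrow> ('a, 'a dist) compiler" where
  "unit_dist X = do {i \<leftarrow> emit (Con 1); State_Monad.return [(Id_on X, i)]}"

fun edge_gate :: "('a \<times> 'a \<Rightarrow> real) \<Rightarrow> 'a option \<times> 'a option \<Rightarrow> 'a gate" where
  "edge_gate p (Some u, Some v) = Con (p (u, v))"
| "edge_gate p (None, Some v) = Inp v"
| "edge_gate p (_, None) = Con 0" (* no edge enters the new vertex *)

definition edge_dist ::
    "('a \<times> 'a \<Rightarrow> real) \<Rightarrow> 'a option \<times> 'a option \<Rightarrow> ('a, 'a dist) compiler" where
  "edge_dist p e = do {
     live \<leftarrow> emit (edge_gate p e);
     one \<leftarrow> emit (Con 1);
     minus_one \<leftarrow> emit (Con (- 1));
     i \<leftarrow> emit (Mul minus_one live);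
     dead \<leftarrow> emit (Add one i);
     State_Monad.return [({e}, live), ({}, dead)]
   }"

definition local_dist ::
    "'a pair_pre_digraph \<Rightarrow> ('a \<times> 'a \<Rightarrow> real) \<Rightarrow> ('b \<Rightarrow> 'a set) \<Rightarrow> ('a option \<times> 'a option \<Rightarrow> 'b)
       \<Rightarrow> 'b \<Rightarrow> ('a, 'a dist) compiler" where
  "local_dist G p B own x = do {
     D \<leftarrow> unit_dist (ext_bag B x);
     foldM (\<lambda>e D. do {
        De \<leftarrow> edge_dist p e;
        combine (ext_bag B x) (ext_bag B x) D De
      }) (enum {e \<in> extended_edges G. own e = x}) D
   }"

text \<open>
  \<open>M (x, y)\<close> is the message \<open>M\<^bsub>x\<rightarrow>y\<^esub>\<close>. The sum over all tuples is computed by combining one neighbor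
  at a time, which gives the same distribution (closure of unions is associative and products
  distribute over sums) but does not enumerate a number of tuples exponential in the degree.
\<close>

definition absorb ::
    "('b \<Rightarrow> 'a set) \<Rightarrow> 'b \<Rightarrow> ('b \<times> 'b \<Rightarrow> 'a dist) \<Rightarrow> 'b list \<Rightarrow> 'a dist \<Rightarrow> ('a, 'a dist) compiler" where
  "absorb B x M = foldM (\<lambda>z D. combine (ext_bag B x) (ext_bag B x) D (M (z, x)))"

definition upward ::
    "'b rtree \<Rightarrow> ('b \<Rightarrow> 'a set) \<Rightarrow> ('b \<Rightarrow> 'a dist) \<Rightarrow> ('b \<times> 'b \<Rightarrow> 'a dist)
       \<Rightarrow> ('a, 'b \<times> 'b \<Rightarrow> 'a dist) compiler" where
  "upward t B L =
     foldM (\<lambda>(y, x) M. do {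
        P \<leftarrow> absorb B x M (children t x) (L x);
        U \<leftarrow> unit_dist (ext_bag B x);
        D \<leftarrow> combine (ext_bag B x) (ext_bag B x \<inter> ext_bag B y) P U;
        State_Monad.return (M((x, y) := D))
      }) (rev (tree_arcs t))"

text \<open>
  All messages from \<open>x\<close> to its children \<open>ys\<close>, by prefix and suffix products, so that the cost is
  linear in the degree. \<open>P\<close> is the combination of the local distribution at \<open>x\<close> with the messages
  from the neighbors already passed. The result consists of the updated messages, the combination of
  \<open>P\<close> with the messages from all of \<open>ys\<close>, and the combination of the latter messages alone.
\<close>

primrec send_down ::
    "('b \<Rightarrow> 'a set) \<Rightarrow> 'b \<Rightarrow> 'b list \<Rightarrow> 'a dist \<Rightarrow> ('b \<times> 'b \<Rightarrow> 'a dist)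
       \<Rightarrow> ('a, ('b \<times> 'b \<Rightarrow> 'a dist) \<times> 'a dist \<times> 'a dist) compiler" where
  "send_down B x [] P M = do {
     U \<leftarrow> unit_dist (ext_bag B x);
     State_Monad.return (M, P, U)
   }"
| "send_down B x (y # ys) P M = do {
     P' \<leftarrow> combine (ext_bag B x) (ext_bag B x) P (M (y, x));
     (M', Q, U) \<leftarrow> send_down B x ys P' M;
     D \<leftarrow> combine (ext_bag B x) (ext_bag B x \<inter> ext_bag B y) P U;
     U' \<leftarrow> combine (ext_bag B x) (ext_bag B x) (M (y, x)) U;
     State_Monad.return (M'((x, y) := D), Q, U')
   }"

text \<open>
  The downward sweep also yields the distributions \<open>Q x\<close> of the global reachability relations: there
  the local distribution is combined with the messages from the parent and from all children.
\<close>

definition downward ::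
    "'b rtree \<Rightarrow> ('b \<Rightarrow> 'a set) \<Rightarrow> ('b \<Rightarrow> 'a dist) \<Rightarrow> ('b \<times> 'b \<Rightarrow> 'a dist)
       \<Rightarrow> ('a, ('b \<times> 'b \<Rightarrow> 'a dist) \<times> ('b \<Rightarrow> 'a dist)) compiler" where
  "downward t B L M =
     foldM (\<lambda>x (M, Q). do {
        P \<leftarrow> absorb B x M (parents t x) (L x);
        (M', Qx, U) \<leftarrow> send_down B x (children t x) P M;
        State_Monad.return (M', Q(x := Qx))
      }) (nodes t) (M, \<lambda>_. [])"

definition sum_gates :: "nat list \<Rightarrow> ('a, nat) compiler" where
  "sum_gates is = do {z \<leftarrow> emit (Con 0); foldM (\<lambda>i s. emit (Add s i)) is z}"

text \<open>The result is the position of the gate computing \<open>F(\<theta>) = (\<Sum>u\<in>V. P\<^sub>\<theta>(\<rho> \<leadsto> u))\<close>.\<close>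

definition compile ::
    "'a pair_pre_digraph \<Rightarrow> ('a \<times> 'a \<Rightarrow> real) \<Rightarrow> 'b rtree \<Rightarrow> ('b \<Rightarrow> 'a set)
       \<Rightarrow> ('a option \<times> 'a option \<Rightarrow> 'b) \<Rightarrow> ('a \<Rightarrow> 'b) \<Rightarrow> ('a, nat) compiler" where
  "compile G p t B own rd = do {
     L \<leftarrow> foldM (\<lambda>x L. do {D \<leftarrow> local_dist G p B own x; State_Monad.return (L(x := D))})
           (nodes t) (\<lambda>_. []);
     M \<leftarrow> upward t B L (\<lambda>_. []);
     (M', Q) \<leftarrow> downward t B L M;
     F \<leftarrow> emit (Con 0);
     foldM (\<lambda>v F. do {
        P \<leftarrow> sum_gates (map snd (filter (\<lambda>(R, i). (None, Some v) \<in> R) (Q (rd v))));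
        emit (Add F P)
      }) (enum (pverts G)) F
   }"


section \<open>Exact Greedy\<close>

text \<open>
  One round. Finding all maximizers of the gradient takes two comparisons per candidate vertex: one
  to determine the maximum and one to compare with it.
\<close>

definition exact_greedy_round ::
    "('a set \<Rightarrow> 'a set \<Rightarrow> 'a) \<Rightarrow> 'a pair_pre_digraph \<Rightarrow> 'a gate list \<Rightarrow> nat
       \<Rightarrow> 'a set \<times> nat \<Rightarrow> 'a set \<times> nat" where
  "exact_greedy_round tie G c out = (\<lambda>(S, k).
     let (vs, k1) = forward c (indicat_real S);
         (g, k2) = backward c out vs
     in (S \<union> {select tie G S g}, k + k1 + k2 + 2 * card (pverts G - S)))"

text \<open>
  The result consists of the seed set, the number of arithmetic operations, and the number of
  operations on relations spent on preprocessing.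
\<close>

definition exact_greedy ::
    "('a set \<Rightarrow> 'a set \<Rightarrow> 'a) \<Rightarrow> 'a pair_pre_digraph \<Rightarrow> ('a \<times> 'a \<Rightarrow> real) \<Rightarrow> 'b rtree \<Rightarrow> ('b \<Rightarrow> 'a set)
       \<Rightarrow> ('a option \<times> 'a option \<Rightarrow> 'b) \<Rightarrow> ('a \<Rightarrow> 'b) \<Rightarrow> nat \<Rightarrow> 'a set \<times> nat \<times> nat" where
  "exact_greedy tie G p t B own rd K =
     (let (out, c, prep) = run_state (compile G p t B own rd) ([], 0);
          (S, ops) = (exact_greedy_round tie G c out ^^ K) ({}, 0)
      in (S, ops, prep))"

end

theory Submission
  imports Defs
begin

text \<open>
  The live-edge probabilities may be replaced by arbitrary real weights, so \<open>F\<close> becomes a polynomial that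
  is affine in each \<open>\<theta>\<^sub>v\<close>. Hence for \<open>v \<notin> S\<close> its partial derivative at \<open>\<one>\<^sub>S\<close> is the difference of its
  values at \<open>\<one>\<^bsub>S \<union> {v}\<^esub>\<close> and \<open>\<one>\<^sub>S\<close>, the marginal gain of \<open>v\<close>, and both algorithms maximize the same
  scores.

  The compiled circuit computes \<open>F\<close> because bags separate: edge sets owned by different branches of the
  decomposition at a node \<open>x\<close> share only vertices of the bag of \<open>x\<close>, so that a live path alternates between
  them inside the bag, and the closure of the union of their reachability relations on the bag is the
  reachability relation of their union. Every distribution lists at most \<open>2 ^ ((w + 2)\<^sup>2)\<close> relations, and
  every tree arc causes a bounded number of combinations.
\<close>

section \<open>Circuits and reverse-mode differentiation\<close>

text \<open>Each \<open>indicat_real S\<close> is a corner of the unit cube, while a derivative is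
  two-sided. The output gate must therefore agree with \<open>F\<close> for all real \<theta>, so
  the argument about the circuit uses finite signed sums instead of pmfs. Circuit and gradient are
  decoupled: reverse mode returns the derivative of whatever function the output gate computes, and
  the sweeps only have to be a correct formula for that function. The sweeps raise two obstacles. A
  message records reachability only on a separator, yet it is combined at a whole bag. Nothing is
  lost, because every endpoint of its edges inside the receiving bag already lies in the separator;
  the set \<open>Y\<close> in \<open>branch\<close> expresses this. Moreover, distributions name
  gates by their position in a circuit that keeps growing, so every assertion has to be stable under
  \<open>extends\<close>; the bounds on gates and on relation operations travel through the same
  triples.\<close>

abbreviation gate_values :: "'a gate list \<Rightarrow> ('a \<Rightarrow> real) \<Rightarrow> real list" where
  "gate_values c \<theta> \<equiv> fst (forward c \<theta>)"

abbreviation gate_value :: "'a gate list \<Rightarrow> ('a \<Rightarrow> real) \<Rightarrow> nat \<Rightarrow> real" where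
  "gate_value c \<theta> i \<equiv> gate_values c \<theta> ! i"

fun operands :: "'a gate \<Rightarrow> nat set" where
  "operands (Add i j) = {i, j}"
| "operands (Mul i j) = {i, j}"
| "operands _ = {}"

text \<open>Operands strictly precede their gate, so the reverse pass reaches a gate only after all
  gates that use it, when its adjoint is complete.\<close>

definition wf_circuit :: "'a gate list \<Rightarrow> bool" where
  "wf_circuit c \<longleftrightarrow> (\<forall>m<length c. operands (c ! m) \<subseteq> {..<m})"

lemma wf_circuit_Nil [simp]: "wf_circuit []"
  by (simp add: wf_circuit_def)

lemma wf_circuit_snoc [simp]:
  "wf_circuit (c @ [g]) \<longleftrightarrow> wf_circuit c \<and> operands g \<subseteq> {..<length c}"
  by (auto simp: wf_circuit_def nth_append less_Suc_eq)

lemma forward_Nil [simp]: "forward [] \<theta> = ([], 0)"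
  by (simp add: forward_def)

lemma forward_snoc [simp]: "forward (c @ [g]) \<theta> = forward_step \<theta> g (forward c \<theta>)"
  by (simp add: forward_def)

lemma forward_step_gate_values:
  "\<exists>r. fst (forward_step \<theta> g vk) = fst vk @ [r]"
  by (cases g; cases vk) auto

lemma length_gate_values [simp]: "length (gate_values c \<theta>) = length c"
proof (induction c rule: rev_induct)
  case (snoc g c)
  then show ?case
    using forward_step_gate_values[of \<theta> g "forward c \<theta>"] by auto
qed simp

lemma prefix_gate_values: "prefix (gate_values c \<theta>) (gate_values (c @ d) \<theta>)"
proof (induction d rule: rev_induct)
  case (snoc g d)
  then show ?case
    using forward_step_gate_values[of \<theta> g "forward (c @ d) \<theta>"]
    by (auto simp flip: append_assoc intro: prefix_prefix)
qed simp

lemma gate_value_prefix: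
  assumes "prefix c c'" "i < length c"
  shows "gate_value c' \<theta> i = gate_value c \<theta> i"
proof -
  obtain d where d: "c' = c @ d"
    using assms(1) by (auto elim: prefixE)
  obtain zs where "gate_values c' \<theta> = gate_values c \<theta> @ zs"
    using prefix_gate_values[of c \<theta> d] d by (auto elim: prefixE)
  then show ?thesis
    using assms(2) by (simp add: nth_append)
qed

lemma gate_value_snoc [simp]:
  "gate_value (c @ [g]) \<theta> (length c) =
     (case g of Con r \<Rightarrow> r | Inp v \<Rightarrow> \<theta> v
      | Add i j \<Rightarrow> gate_value c \<theta> i + gate_value c \<theta> j
      | Mul i j \<Rightarrow> gate_value c \<theta> i * gate_value c \<theta> j)"
  by (cases g; cases "forward c \<theta>")
    (auto simp: nth_append simp flip: length_gate_values[of c \<theta>])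

lemma forward_cost: "snd (forward c \<theta>) \<le> length c"
proof (induction c rule: rev_induct)
  case (snoc g c)
  then show ?case by (cases g; cases "forward c \<theta>") auto
qed simp

text \<open>The forward-mode rule for a single gate. It splits the correctness of reverse mode in
  two: the reverse pass is adjoint to this recurrence, which is pure algebra, and the recurrence
  yields true derivatives, which is calculus.\<close>

fun tangent_step :: "(nat \<Rightarrow> real) \<Rightarrow> 'a \<Rightarrow> 'a gate \<Rightarrow> (nat \<Rightarrow> real) \<Rightarrow> real" where
  "tangent_step vs v (Con r) d = 0"
| "tangent_step vs v (Inp u) d = of_bool (u = v)"
| "tangent_step vs v (Add i j) d = d i + d j"
| "tangent_step vs v (Mul i j) d = d i * vs j + vs i * d j"

text \<open>
  The reverse pass preserves \<open>(\<Sum>i<m. a i * d i) + g v\<close>, where \<open>m\<close> is the number of gates not yet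
  processed and \<open>d\<close> are the derivatives of the gates with respect to \<open>\<theta>\<^sub>v\<close>.
\<close>

lemma backward_invariant:
  assumes "wf_circuit c"
    and "\<And>m. m < length c \<Longrightarrow> d m = tangent_step ((!) vs) v (c ! m) d"
    and "foldr (backward_step vs) (List.enumerate 0 c) (a, g, k) = (a', g', k')"
  shows "(\<Sum>i<length c. a i * d i) + g v = g' v"
  using assms
proof (induction c arbitrary: a g k rule: rev_induct)
  case (snoc x c)
  let ?m = "length c"
  have wf: "wf_circuit c" and ops: "operands x \<subseteq> {..<?m}"
    using snoc.prems(1) by auto
  obtain a1 g1 k1 where step: "backward_step vs (?m, x) (a, g, k) = (a1, g1, k1)"
    by (metis prod_cases3)
  have "foldr (backward_step vs) (List.enumerate 0 c) (a1, g1, k1) = (a', g', k')"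
    using snoc.prems(3) step by (simp add: enumerate_append_eq)
  moreover have "d m = tangent_step ((!) vs) v (c ! m) d" if "m < length c" for m
    using snoc.prems(2)[of m] that by (simp add: nth_append)
  ultimately have IH: "(\<Sum>i<?m. a1 i * d i) + g1 v = g' v"
    using snoc.IH[OF wf] by blast
  have dm: "d ?m = tangent_step ((!) vs) v x d"
    using snoc.prems(2)[of ?m] by simp
  \<comment> \<open>Stated for arbitrary \<open>f\<close>, so that it rewrites two nested updates in
    turn; this covers gates whose two operands coincide.\<close>
  have upd: "(\<Sum>i<?m. (f(j := f j + r)) i * d i) = (\<Sum>i<?m. f i * d i) + r * d j"
    if "j < ?m" for f j r
  proof -
    have "(\<Sum>i<?m. (f(j := f j + r)) i * d i) = (\<Sum>i<?m. f i * d i + (if i = j then r * d j else 0))"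
      by (intro sum.cong) (auto simp: algebra_simps)
    then show ?thesis
      using that by (simp add: sum.distrib)
  qed
  have "(\<Sum>i<?m. a1 i * d i) + g1 v = (\<Sum>i<?m. a i * d i) + a ?m * d ?m + g v"
  proof (cases x)
    case (Add i j)
    then have "i < ?m" "j < ?m" using ops by auto
    moreover have "a1 = (let a' = a(i := a i + a ?m) in a'(j := a' j + a ?m))" "g1 = g"
      using step Add by (auto simp: Let_def)
    ultimately show ?thesis
      using Add dm unfolding Let_def
      by (simp only: upd) (simp add: algebra_simps)
  next
    case (Mul i j)
    then have "i < ?m" "j < ?m" using ops by auto
    moreover have "a1 = (let a' = a(i := a i + a ?m * vs ! j) in a'(j := a' j + a ?m * vs ! i))"
      "g1 = g"
      using step Mul by (auto simp: Let_def)
    ultimately show ?thesis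
      using Mul dm unfolding Let_def
      by (simp only: upd) (simp add: algebra_simps)
  qed (use step dm in auto)
  then show ?case
    using IH by simp
qed simp

lemma gate_value_has_derivative:
  assumes "wf_circuit c"
  obtains d where
    "\<And>m. m < length c \<Longrightarrow> d m = tangent_step (gate_value c \<theta>) v (c ! m) d"
    "\<And>m. m < length c \<Longrightarrow>
       ((\<lambda>s. gate_value c (\<theta>(v := s)) m) has_real_derivative d m) (at (\<theta> v))"
  using assms
proof (induction c arbitrary: thesis rule: rev_induct)
  case (snoc g c)
  have wf: "wf_circuit c" and ops: "operands g \<subseteq> {..<length c}"
    using snoc.prems(2) by auto
  obtain d where d: "\<And>m. m < length c \<Longrightarrow> d m = tangent_step (gate_value c \<theta>) v (c ! m) d"
    and D: "\<And>m. m < length c \<Longrightarrow>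
      ((\<lambda>s. gate_value c (\<theta>(v := s)) m) has_real_derivative d m) (at (\<theta> v))"
    using snoc.IH wf by blast
  have old: "gate_value (c @ [g]) \<theta>' m = gate_value c \<theta>' m" if "m < length c" for m \<theta>'
    using that by (intro gate_value_prefix) auto
  have cong: "tangent_step vs v g' d1 = tangent_step vs' v g' d2"
    if "\<And>i. i \<in> operands g' \<Longrightarrow> d1 i = d2 i \<and> vs i = vs' i" for vs vs' g' and d1 d2 :: "nat \<Rightarrow> real"
    using that by (cases g') auto
  define d' where "d' = d(length c := tangent_step (gate_value c \<theta>) v g d)"
  show ?case
  proof (rule snoc.prems(1)[of d'])
    fix m assume m: "m < length (c @ [g])"
    define g' where "g' = (c @ [g]) ! m"
    have "operands g' \<subseteq> {..<m}"
      using m snoc.prems(2) unfolding g'_def wf_circuit_def by blast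
    then have "i < length c" if "i \<in> operands g'" for i
      using that m by auto
    then have "tangent_step (gate_value (c @ [g]) \<theta>) v g' d' = tangent_step (gate_value c \<theta>) v g' d"
      by (intro cong) (auto simp: d'_def old simp del: forward_snoc)
    then show "d' m = tangent_step (gate_value (c @ [g]) \<theta>) v ((c @ [g]) ! m) d'"
      using m d[of m] unfolding g'_def by (auto simp: d'_def nth_append less_Suc_eq)
    show "((\<lambda>s. gate_value (c @ [g]) (\<theta>(v := s)) m) has_real_derivative d' m) (at (\<theta> v))"
    proof (cases "m = length c")
      case True
      have 1: "((\<lambda>s. gate_value c (\<theta>(v := s)) i) has_real_derivative d i) (at (\<theta> v))"
        if "i \<in> operands g" for i
        using D that ops by blast
      show ?thesis
        using True 1
        by (cases g) (auto simp: d'_def simp del: forward_snoc intro!: derivative_eq_intros)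
    next
      case False
      then show ?thesis using D[of m] m by (simp add: old d'_def del: forward_snoc)
    qed
  qed
qed simp

text \<open>Since derivatives are unique, only the function computed by the output gate matters, not
  the shape of the circuit.\<close>

lemma backward_derivative:
  assumes "wf_circuit c" "out < length c"
    and "((\<lambda>s. gate_value c (\<theta>(v := s)) out) has_real_derivative D) (at (\<theta> v))"
  shows "fst (backward c out (gate_values c \<theta>)) v = D"
proof -
  obtain d where d: "\<And>m. m < length c \<Longrightarrow> d m = tangent_step (gate_value c \<theta>) v (c ! m) d"
    "\<And>m. m < length c \<Longrightarrow>
       ((\<lambda>s. gate_value c (\<theta>(v := s)) m) has_real_derivative d m) (at (\<theta> v))"
    using gate_value_has_derivative[OF assms(1)] by blast
  obtain a' g' k' where r: "foldr (backward_step (gate_values c \<theta>)) (List.enumerate 0 c)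
      ((\<lambda>_. 0)(out := 1), \<lambda>_. 0, 0) = (a', g', k')"
    by (metis prod_cases3)
  have "g' v = (\<Sum>i<length c. ((\<lambda>_. 0)(out := 1)) i * d i)"
    using backward_invariant[OF assms(1) d(1) r] by simp
  also have "\<dots> = (\<Sum>i<length c. if i = out then d i else 0)"
    by (intro sum.cong) auto
  also have "\<dots> = d out"
    using assms(2) by simp
  also have "\<dots> = D"
    using d(2)[OF assms(2)] assms(3) by (rule DERIV_unique)
  finally show ?thesis
    using r by (simp add: backward_def)
qed

text \<open>The worst case is a product gate, with two multiplications and two additions.\<close>

lemma backward_step_cost: "snd (snd (backward_step vs (m, x) s)) \<le> snd (snd s) + 4"
  by (cases x; cases s) (auto simp: Let_def)

lemma backward_cost: "snd (backward c out vs) \<le> 4 * length c"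
proof -
  have "snd (snd (foldr (backward_step vs) xs s)) \<le> snd (snd s) + 4 * length xs" for xs s
  proof (induction xs)
    case (Cons x xs)
    then show ?case
      using backward_step_cost[of vs "fst x" "snd x" "foldr (backward_step vs) xs s"] by auto
  qed simp
  from this[of "List.enumerate 0 c" "((\<lambda>_. 0)(out := 1), \<lambda>_. 0, 0)"] show ?thesis
    by (simp add: backward_def)
qed

section \<open>Random edge sets with real weights\<close>

text \<open>
  The weights are arbitrary reals rather than probabilities, so that identities proved for them are
  polynomial identities and can be differentiated.
\<close>

definition weight :: "('e \<Rightarrow> real) \<Rightarrow> 'e set \<Rightarrow> 'e set \<Rightarrow> real" where
  "weight wt A L = (\<Prod>e\<in>A. if e \<in> L then wt e else 1 - wt e)"

definition expect :: "('e \<Rightarrow> real) \<Rightarrow> 'e set \<Rightarrow> ('e set \<Rightarrow> real) \<Rightarrow> real" where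
  "expect wt A f = (\<Sum>L\<in>Pow A. weight wt A L * f L)"

lemma expect_cong:
  assumes "\<And>e. e \<in> A \<Longrightarrow> wt e = wt' e" "\<And>L. L \<subseteq> A \<Longrightarrow> f L = f' L"
  shows "expect wt A f = expect wt' A f'"
  unfolding expect_def weight_def by (intro sum.cong arg_cong2[of _ _ _ _ "(*)"] prod.cong)
    (use assms in auto)

lemma expect_empty [simp]: "expect wt {} f = f {}"
  by (simp add: expect_def weight_def)

lemma expect_singleton: "expect wt {e} f = wt e * f {e} + (1 - wt e) * f {}"
  by (simp add: expect_def weight_def Pow_insert)

lemma weight_Un:
  assumes "finite A" "finite B" "A \<inter> B = {}" "L1 \<subseteq> A" "L2 \<subseteq> B"
  shows "weight wt (A \<union> B) (L1 \<union> L2) = weight wt A L1 * weight wt B L2"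
  unfolding weight_def
  by (subst prod.union_disjoint)
    (use assms in \<open>auto intro!: arg_cong2[of _ _ _ _ "(*)"] prod.cong\<close>)

text \<open>Independence of disjoint edge sets in the form of Fubini's theorem. It is only a
  factorization of products, hence valid for arbitrary real weights.\<close>

lemma expect_Un:
  assumes "finite A" "finite B" "A \<inter> B = {}"
  shows "expect wt (A \<union> B) f = expect wt A (\<lambda>L1. expect wt B (\<lambda>L2. f (L1 \<union> L2)))"
proof -
  have "bij_betw (\<lambda>(L1, L2). L1 \<union> L2) (Pow A \<times> Pow B) (Pow (A \<union> B))"
    by (rule bij_betw_byWitness[where f' = "\<lambda>L. (L \<inter> A, L \<inter> B)"]) (use assms(3) in auto)
  then have "expect wt (A \<union> B) f =
      (\<Sum>(L1, L2)\<in>Pow A \<times> Pow B. weight wt (A \<union> B) (L1 \<union> L2) * f (L1 \<union> L2))"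
    unfolding expect_def
    by (subst sum.reindex_bij_betw[symmetric], assumption) (simp add: case_prod_beta)
  also have "\<dots> = (\<Sum>(L1, L2)\<in>Pow A \<times> Pow B. weight wt A L1 * (weight wt B L2 * f (L1 \<union> L2)))"
    by (intro sum.cong) (auto simp: weight_Un[OF assms])
  finally show ?thesis
    unfolding expect_def by (simp add: sum.cartesian_product[symmetric] sum_distrib_left)
qed

lemma expect_image:
  assumes "inj h"
  shows "expect wt (h ` A) f = expect (wt \<circ> h) A (\<lambda>L. f (h ` L))"
proof -
  have "inj_on h A"
    using assms inj_on_subset by blast
  then have "bij_betw (\<lambda>L. h ` L) (Pow A) (Pow (h ` A))"
    by (intro bij_betw_Pow) (simp add: bij_betw_def)
  moreover have "weight wt (h ` A) (h ` L) = weight (wt \<circ> h) A L" for L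
    unfolding weight_def using \<open>inj_on h A\<close> assms
    by (subst prod.reindex) (auto simp: inj_image_mem_iff intro!: prod.cong)
  ultimately show ?thesis
    unfolding expect_def by (subst sum.reindex_bij_betw[symmetric, of _ "Pow A"]) auto
qed

text \<open>With weights 0 and 1 the live edge set is deterministic: any subset other than
  \<open>A \<inter> T\<close> has a vanishing factor.\<close>

lemma expect_indicator:
  assumes "finite A" "\<And>e. e \<in> A \<Longrightarrow> wt e = indicat_real T e"
  shows "expect wt A f = f (A \<inter> T)"
proof -
  have "weight wt A L = of_bool (L = A \<inter> T)" if "L \<subseteq> A" for L
  proof (cases "L = A \<inter> T")
    case True
    then show ?thesis
      unfolding weight_def using assms by (auto intro!: prod.neutral)
  next
    case False
    then have "\<exists>e\<in>A. (e \<in> L) \<noteq> (e \<in> T)"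
      using that False unfolding set_eq_iff by (metis IntD1 IntD2 IntI subsetD)
    then obtain e where "e \<in> A" "(e \<in> L) \<noteq> (e \<in> T)"
      by blast
    then show ?thesis
      unfolding weight_def using assms False by (auto intro!: prod_zero bexI[of _ e])
  qed
  then have "expect wt A f = (\<Sum>L\<in>Pow A. if L = A \<inter> T then f L else 0)"
    unfolding expect_def by (intro sum.cong) auto
  then show ?thesis
    using assms(1) by simp
qed

lemma expect_sum: "expect wt A (\<lambda>L. \<Sum>i\<in>I. f i L) = (\<Sum>i\<in>I. expect wt A (f i))"
  unfolding expect_def by (simp add: sum_distrib_left) (rule sum.swap)

text \<open>The bridge to the probabilistic model. Here the weights must lie in [0,1], so that
  \<open>bernoulli_pmf\<close> has them as success probabilities.\<close>

lemma expectation_live_edges: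
  assumes "finite E" "\<And>e. e \<in> E \<Longrightarrow> 0 \<le> p e \<and> p e \<le> 1"
  shows "measure_pmf.expectation (live_edges E p) (\<lambda>\<omega>. f {e \<in> E. \<omega> e}) = expect p E f"
proof -
  let ?\<Omega> = "(\<lambda>L e. e \<in> L) ` Pow E"
  \<comment> \<open>Outside \<open>E\<close> the product measure takes the default value
    \<open>False\<close>, so its support can be identified with subsets of \<open>E\<close>.\<close>
  have "set_pmf (live_edges E p) \<subseteq> ?\<Omega>"
  proof
    fix \<omega> assume "\<omega> \<in> set_pmf (live_edges E p)"
    then have "\<forall>e. e \<notin> E \<longrightarrow> \<not> \<omega> e"
      using assms(1) by (auto simp: live_edges_def set_pmf_iff pmf_Pi split: if_splits)
    then show "\<omega> \<in> ?\<Omega>"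
      by (intro image_eqI[of _ _ "{e \<in> E. \<omega> e}"]) (auto simp: fun_eq_iff simp del: split_paired_All)
  qed
  then have "measure_pmf.expectation (live_edges E p) (\<lambda>\<omega>. f {e \<in> E. \<omega> e}) =
      (\<Sum>\<omega>\<in>?\<Omega>. f {e \<in> E. \<omega> e} * pmf (live_edges E p) \<omega>)"
    using assms(1) by (subst integral_measure_pmf_real[of ?\<Omega>]) auto
  also have "\<dots> = (\<Sum>L\<in>Pow E. f {e \<in> E. e \<in> L} * pmf (live_edges E p) (\<lambda>e. e \<in> L))"
    by (subst sum.reindex) (auto simp: inj_on_def fun_eq_iff)
  also have "\<dots> = expect p E f"
    unfolding expect_def
  proof (intro sum.cong refl)
    fix L assume "L \<in> Pow E"
    then have "{e \<in> E. e \<in> L} = L" by auto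
    moreover have "pmf (live_edges E p) (\<lambda>e. e \<in> L) = weight p E L"
      unfolding live_edges_def weight_def using assms \<open>L \<in> Pow E\<close>
      by (subst pmf_Pi) (auto intro!: prod.cong)
    ultimately show "f {e \<in> E. e \<in> L} * pmf (live_edges E p) (\<lambda>e. e \<in> L) = weight p E L * f L"
      by simp
  qed
  finally show ?thesis .
qed

section \<open>The multilinear extension of the influence function\<close>

text \<open>The value 0 for edges into \<open>None\<close> mirrors \<open>edge_gate\<close>, so that
  compiled edges have the right weight for all pairs, without a case distinction on which pairs are
  edges.\<close>

fun edge_weight :: "('a \<times> 'a \<Rightarrow> real) \<Rightarrow> ('a \<Rightarrow> real) \<Rightarrow> 'a option \<times> 'a option \<Rightarrow> real" where
  "edge_weight p \<theta> (Some u, Some v) = p (u, v)"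
| "edge_weight p \<theta> (None, Some v) = \<theta> v"
| "edge_weight p \<theta> (_, None) = 0"

definition reach_count :: "'a pair_pre_digraph \<Rightarrow> 'a option rel \<Rightarrow> real" where
  "reach_count G L = (\<Sum>u\<in>pverts G. of_bool ((None, Some u) \<in> L\<^sup>*))"

definition extended_influence ::
    "'a pair_pre_digraph \<Rightarrow> ('a \<times> 'a \<Rightarrow> real) \<Rightarrow> ('a \<Rightarrow> real) \<Rightarrow> real" where
  "extended_influence G p \<theta> = expect (edge_weight p \<theta>) (extended_edges G) (reach_count G)"

lemma finite_extended_edges:
  assumes "pair_fin_digraph G"
  shows "finite (extended_edges G)"
proof -
  interpret pair_fin_digraph G by fact
  have "artificial_edges G = (\<lambda>v. (None, Some v)) ` pverts G"
    by (auto simp: artificial_edges_def)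
  then show ?thesis
    using pair_finite_verts pair_finite_arcs by (simp add: extended_edges_def)
qed

lemma extended_influence_has_derivative:
  assumes "pair_fin_digraph G" "v \<in> pverts G"
  shows "((\<lambda>s. extended_influence G p (\<theta>(v := s))) has_real_derivative
           extended_influence G p (\<theta>(v := 1)) - extended_influence G p (\<theta>(v := 0))) (at x)"
proof -
  let ?e = "(None, Some v) :: 'a option \<times> 'a option"
  \<comment> \<open>Only the artificial edge into \<open>v\<close> depends on the coordinate
    \<open>v\<close>. Conditioning on it leaves \<open>F {?e}\<close> when it is live and
    \<open>F {}\<close> when it is dead, which makes the function affine in
    \<open>s\<close>.\<close>
  define A where "A = extended_edges G - {?e}"
  define F where "F b = expect (edge_weight p \<theta>) A (\<lambda>L. reach_count G (b \<union> L))" for b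
  have E: "extended_edges G = {?e} \<union> A" "finite A" "{?e} \<inter> A = {}"
    using assms finite_extended_edges[of G]
    by (auto simp: A_def extended_edges_def artificial_edges_def)
  have "edge_weight p (\<theta>(v := s)) e = edge_weight p \<theta> e" if "e \<in> A" for s e
    using that by (cases "(p, \<theta>, e)" rule: edge_weight.cases) (auto simp: A_def)
  then have "expect (edge_weight p (\<theta>(v := s))) A f = expect (edge_weight p \<theta>) A f" for s f
    by (intro expect_cong) auto
  then have *: "extended_influence G p (\<theta>(v := s)) = s * F {?e} + (1 - s) * F {}" for s
    unfolding extended_influence_def E(1)
    by (subst expect_Un) (use E in \<open>auto simp: expect_singleton F_def\<close>)
  show ?thesis
    unfolding * by (auto intro!: derivative_eq_intros)
qed

text \<open>No edge enters \<open>None\<close>, so a path from it uses an artificial edge exactly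
  once, as its first step, and then continues inside the original graph.\<close>

lemma reach_from_None:
  "(None, Some u) \<in> (map_prod Some Some ` L \<union> {(None, Some s) | s. s \<in> S})\<^sup>*
     \<longleftrightarrow> (\<exists>s\<in>S. (s, u) \<in> L\<^sup>*)"
  (is "_ \<in> ?R\<^sup>* \<longleftrightarrow> _")
proof
  have "y = None \<or> (\<exists>u. y = Some u \<and> (\<exists>s\<in>S. (s, u) \<in> L\<^sup>*))" if "(None, y) \<in> ?R\<^sup>*" for y
    using that
  proof (induction rule: rtrancl_induct)
    case (step y z)
    from step.hyps(2) consider (edge) a b where "y = Some a" "z = Some b" "(a, b) \<in> L"
      | (source) s where "z = Some s" "s \<in> S"
      by auto
    then show ?case
    proof cases
      case edge
      then obtain s where "s \<in> S" "(s, a) \<in> L\<^sup>*"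
        using step.IH by auto
      then have "(s, b) \<in> L\<^sup>*"
        using edge(3) by (simp add: rtrancl_into_rtrancl)
      then show ?thesis using edge(2) \<open>s \<in> S\<close> by blast
    next
      case source
      then show ?thesis by blast
    qed
  qed simp
  from this[of "Some u"] show "\<exists>s\<in>S. (s, u) \<in> L\<^sup>*" if "(None, Some u) \<in> ?R\<^sup>*"
    using that by simp
next
  assume "\<exists>s\<in>S. (s, u) \<in> L\<^sup>*"
  then obtain s where s: "s \<in> S" "(s, u) \<in> L\<^sup>*" by blast
  from s(2) have "(Some s, Some u) \<in> ?R\<^sup>*"
  proof (induction rule: rtrancl_induct)
    case (step y z)
    have "(Some y, Some z) \<in> map_prod Some Some ` L"
      by (rule image_eqI[OF _ step.hyps(2)]) simp
    then have "(Some y, Some z) \<in> ?R" by (rule UnI1)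
    with step.IH show ?case by (rule rtrancl_into_rtrancl)
  qed simp
  moreover have "(None, Some s) \<in> ?R"
    using s(1) by simp
  ultimately show "(None, Some u) \<in> ?R\<^sup>*"
    by (rule converse_rtrancl_into_rtrancl[rotated])
qed

lemma extended_influence_indicator:
  assumes "pair_fin_digraph G" "\<And>e. e \<in> parcs G \<Longrightarrow> 0 \<le> p e \<and> p e \<le> 1"
  shows "extended_influence G p (indicat_real S) = influence G p S"
proof -
  interpret pair_fin_digraph G by fact
  let ?wt = "edge_weight p (indicat_real S)"
  let ?art = "{(None, Some s) | s. s \<in> S \<inter> pverts G}"
  have fin: "finite (parcs G)" "finite (pverts G)" "finite (artificial_edges G)"
    using finite_extended_edges[OF assms(1)] by (auto simp: extended_edges_def)
  have art: "expect ?wt (artificial_edges G) f = f ?art" for f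
  proof -
    have "expect ?wt (artificial_edges G) f =
        f (artificial_edges G \<inter> {(None, Some s) | s. s \<in> S})"
      using fin(3) by (intro expect_indicator) (auto simp: artificial_edges_def indicator_def)
    also have "artificial_edges G \<inter> {(None, Some s) | s. s \<in> S} = ?art"
      by (auto simp: artificial_edges_def)
    finally show ?thesis .
  qed
  have "extended_influence G p (indicat_real S) =
      expect ?wt (map_prod Some Some ` parcs G) (\<lambda>L. reach_count G (L \<union> ?art))"
    unfolding extended_influence_def extended_edges_def
    by (subst expect_Un) (use fin in \<open>auto simp: art\<close>, auto simp: artificial_edges_def)
  also have "\<dots> = expect p (parcs G) (\<lambda>L. reach_count G (map_prod Some Some ` L \<union> ?art))"
    by (subst expect_image) (auto intro!: expect_cong prod.inj_map)
  also have "\<dots> = expect p (parcs G) (\<lambda>L. real (card {u \<in> pverts G. \<exists>s\<in>S. (s, u) \<in> L\<^sup>*}))"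
  proof (rule expect_cong)
    fix L assume L: "L \<subseteq> parcs G"
    \<comment> \<open>Artificial edges lead only to vertices of \<open>G\<close>. Seeds outside
      activate no vertex: a path of length zero stays outside, and edges of \<open>G\<close> start
      inside.\<close>
    have "s \<in> pverts G" if "(s, u) \<in> L\<^sup>*" "u \<in> pverts G" for s u
      using that(1)
    proof (cases rule: converse_rtranclE)
      case base
      then show ?thesis using that(2) by simp
    next
      case (step y)
      then show ?thesis using L in_arcsD1 by blast
    qed
    then have "reach_count G (map_prod Some Some ` L \<union> ?art) =
        (\<Sum>u\<in>pverts G. of_bool (\<exists>s\<in>S. (s, u) \<in> L\<^sup>*))"
      unfolding reach_count_def reach_from_None by (intro sum.cong) auto
    then show "reach_count G (map_prod Some Some ` L \<union> ?art) =
        real (card {u \<in> pverts G. \<exists>s\<in>S. (s, u) \<in> L\<^sup>*})"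
      using fin(2) by (simp add: of_bool_def sum.If_cases Int_def)
  qed auto
  also have "\<dots> = influence G p S"
    using expectation_live_edges[OF fin(1) assms(2),
      where f = "\<lambda>L. real (card {u \<in> pverts G. \<exists>s\<in>S. (s, u) \<in> L\<^sup>*})"]
    by (simp add: influence_def activated_def)
  finally show ?thesis .
qed

section \<open>Restricting and combining reachability relations\<close>

text \<open>\<open>R\<close> may replace the edge set \<open>L\<close> when only paths between vertices of \<open>X\<close> matter.\<close>

definition summarizes :: "'v set \<Rightarrow> 'v rel \<Rightarrow> 'v rel \<Rightarrow> bool" where
  "summarizes X R L \<longleftrightarrow> R \<subseteq> L\<^sup>* \<and> L\<^sup>* \<inter> X \<times> X \<subseteq> R\<^sup>*"

lemma rtrancl_Field:
  assumes "(a, b) \<in> L\<^sup>*" "a \<noteq> b"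
  shows "a \<in> Field L" "b \<in> Field L"
proof -
  have "(a, b) \<in> L\<^sup>+" using assms by (auto dest: rtranclD)
  then show "a \<in> Field L" "b \<in> Field L"
    by (auto dest: tranclD tranclD2 intro: FieldI1 FieldI2)
qed

lemma summarizes_refl: "summarizes X L L"
  by (auto simp: summarizes_def)

text \<open>A nontrivial path has both endpoints in \<open>Field L\<close>, hence in
  \<open>Y\<close> if they lie in \<open>X\<close>; trivial paths are supplied by the reflexive
  closure. This is what allows a relation recorded on a small set to be used on the whole
  bag.\<close>

lemma summarizes_reach_rel:
  assumes "Field L \<inter> X \<subseteq> Y"
  shows "summarizes X (reach_rel Y L) L"
proof -
  have "(a, b) \<in> (reach_rel Y L)\<^sup>*" if "(a, b) \<in> L\<^sup>*" "a \<in> X" "b \<in> X" for a b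
  proof (cases "a = b")
    case False
    then have "a \<in> Field L" "b \<in> Field L"
      using rtrancl_Field[OF that(1)] by auto
    then show ?thesis
      using assms that by (auto simp: reach_rel_def)
  qed simp
  then show ?thesis
    by (auto simp: summarizes_def reach_rel_def)
qed

text \<open>
  A path of \<open>L1 \<union> L2\<close> switches between the two edge sets only at vertices incident with both, that
  is, in \<open>X\<close>.
\<close>

lemma reach_rel_combine:
  assumes S1: "summarizes X R1 L1" and S2: "summarizes X R2 L2"
    and sep: "Field L1 \<inter> Field L2 \<subseteq> X" and "Y \<subseteq> X"
  shows "reach_rel Y (R1 \<union> R2) = reach_rel Y (L1 \<union> L2)"
proof -
  have sub: "(R1 \<union> R2)\<^sup>* \<subseteq> (L1 \<union> L2)\<^sup>*"
  proof (rule rtrancl_subset_rtrancl)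
    have "L1\<^sup>* \<union> L2\<^sup>* \<subseteq> (L1 \<union> L2)\<^sup>*"
      by (simp add: rtrancl_mono)
    then show "R1 \<union> R2 \<subseteq> (L1 \<union> L2)\<^sup>*"
      using S1 S2 unfolding summarizes_def by blast
  qed
  have R: "R1\<^sup>* \<union> R2\<^sup>* \<subseteq> (R1 \<union> R2)\<^sup>*"
    by (simp add: rtrancl_mono)
  \<comment> \<open>\<open>m\<close> is the last switching point: the path up to \<open>m\<close> is
    already translated to \<open>R1 \<union> R2\<close>, and the rest runs inside one of the two
    edge sets, possibly ending outside \<open>X\<close>.\<close>
  have "\<exists>m\<in>X. (a, m) \<in> (R1 \<union> R2)\<^sup>* \<and> (m, b) \<in> L1\<^sup>* \<union> L2\<^sup>*"
    if "(a, b) \<in> (L1 \<union> L2)\<^sup>*" "a \<in> X" for a b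
    using that
  proof (induction rule: rtrancl_induct)
    case (step c d)
    \<comment> \<open>One statement for both directions of a switch. The vertex \<open>c\<close>
      becomes the new switching point: it equals the old one or is incident with both edge
      sets.\<close>
    have switch: ?case if m: "m \<in> X" "(a, m) \<in> (R1 \<union> R2)\<^sup>*" "(m, c) \<in> L\<^sup>*"
      and cd: "(c, d) \<in> L'" and LR: "L' = L1 \<or> L' = L2" "R \<subseteq> R1 \<union> R2" "summarizes X R L"
      and sep': "Field L \<inter> Field L' \<subseteq> X" for m L L' R
    proof -
      have "c \<in> X"
      proof (cases "m = c")
        case False
        then have "c \<in> Field L" using rtrancl_Field[OF m(3)] by simp
        moreover have "c \<in> Field L'" using cd by (rule FieldI1)
        ultimately show ?thesis using sep' by blast
      qed (use m in simp)
      then have "(m, c) \<in> R\<^sup>*"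
        using LR(3) m unfolding summarizes_def by blast
      then have "(a, c) \<in> (R1 \<union> R2)\<^sup>*"
        using m(2) rtrancl_mono[OF LR(2)] by (meson rtrancl_trans subsetD)
      then show ?thesis
        using \<open>c \<in> X\<close> cd LR(1) by blast
    qed
    obtain m where m: "m \<in> X" "(a, m) \<in> (R1 \<union> R2)\<^sup>*" "(m, c) \<in> L1\<^sup>* \<union> L2\<^sup>*"
      using step.IH step.prems by blast
    consider "(m, c) \<in> L1\<^sup>*" "(c, d) \<in> L1" | "(m, c) \<in> L2\<^sup>*" "(c, d) \<in> L2"
      | "(m, c) \<in> L1\<^sup>*" "(c, d) \<in> L2" | "(m, c) \<in> L2\<^sup>*" "(c, d) \<in> L1"
      using m(3) step.hyps(2) by blast
    then show ?case
    proof cases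
      case 3
      then show ?thesis using switch[OF m(1,2), of L1 L2 R1] S1 sep by blast
    next
      case 4
      then show ?thesis using switch[OF m(1,2), of L2 L1 R2] S2 sep by blast
    qed (use m in \<open>blast intro: rtrancl_into_rtrancl\<close>)+
  qed (auto intro!: bexI)
  note path = this
  have "(a, b) \<in> (R1 \<union> R2)\<^sup>*" if ab: "(a, b) \<in> (L1 \<union> L2)\<^sup>*" "a \<in> X" "b \<in> X" for a b
  proof -
    obtain m where m: "m \<in> X" "(a, m) \<in> (R1 \<union> R2)\<^sup>*" "(m, b) \<in> L1\<^sup>* \<union> L2\<^sup>*"
      using path[OF ab(1,2)] by blast
    then have "(m, b) \<in> R1\<^sup>* \<union> R2\<^sup>*"
      using S1 S2 ab(3) unfolding summarizes_def by blast
    then have "(m, b) \<in> (R1 \<union> R2)\<^sup>*"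
      using R by blast
    then show ?thesis
      using m(2) by (rule rtrancl_trans[rotated])
  qed
  then show ?thesis
    using sub \<open>Y \<subseteq> X\<close> unfolding reach_rel_def by blast
qed

section \<open>Rooted trees\<close>

text \<open>The arcs of a rooted tree, in an order in which every vertex is reached before it is left.\<close>

inductive arborescence :: "'b \<Rightarrow> ('b \<times> 'b) list \<Rightarrow> bool" for r where
  Nil: "arborescence r []"
| snoc: "arborescence r as \<Longrightarrow> a \<in> insert r (snd ` set as) \<Longrightarrow> b \<notin> insert r (snd ` set as) \<Longrightarrow>
    arborescence r (as @ [(a, b)])"

lemma arborescence_append:
  assumes "arborescence a bs" "arborescence r as" "a \<in> insert r (snd ` set as)"
    "snd ` set bs \<inter> insert r (snd ` set as) = {}"
  shows "arborescence r (as @ bs)"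
  using assms
proof (induction)
  case (snoc bs c d)
  have vs: "snd ` set (bs @ [(c, d)]) = insert d (snd ` set bs)"
    "snd ` set (as @ bs) = snd ` set as \<union> snd ` set bs"
    by auto
  have "arborescence r (as @ bs)"
    by (rule snoc.IH) (use snoc.prems vs(1) in blast)+
  then have "arborescence r ((as @ bs) @ [(c, d)])"
    by (rule arborescence.snoc; unfold vs(2)) (use snoc.hyps(2,3) snoc.prems vs(1) in blast)+
  then show ?case by simp
qed simp

lemma arborescence_source:
  assumes "arborescence r as" "as = xs @ (a, b) # ys"
  shows "a \<in> insert r (snd ` set xs)"
  using assms
proof (induction arbitrary: ys)
  case (snoc as c d)
  then show ?case
    by (cases ys rule: rev_cases) auto
qed simp

lemma arborescence_Field: "arborescence r as \<Longrightarrow> Field (set as) \<subseteq> insert r (snd ` set as)"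
  by (induction rule: arborescence.induct) auto

lemma arborescence_acyclic: "arborescence r as \<Longrightarrow> acyclic (set as)"
proof (induction rule: arborescence.induct)
  case (snoc as a b)
  have "(b, a) \<notin> (set as)\<^sup>*"
    using snoc.hyps(2,3) arborescence_Field[OF snoc.hyps(1)] rtrancl_Field(1)[of b a "set as"]
    by blast
  then show ?case
    using snoc.IH by (simp add: acyclic_insert)
qed (simp add: acyclic_def)

lemma arborescence_reach:
  "arborescence r as \<Longrightarrow> x \<in> insert r (snd ` set as) \<Longrightarrow> (r, x) \<in> (set as)\<^sup>*"
proof (induction arbitrary: x rule: arborescence.induct)
  case (snoc as a b)
  have "(set as)\<^sup>* \<subseteq> (set (as @ [(a, b)]))\<^sup>*"
    by (intro rtrancl_mono) auto
  then have "(r, y) \<in> (set (as @ [(a, b)]))\<^sup>*" if "y \<in> insert r (snd ` set as)" for y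
    using snoc.IH that by blast
  moreover have "(a, b) \<in> set (as @ [(a, b)])" by simp
  ultimately show ?case
    using snoc.prems snoc.hyps(2) by (auto intro: rtrancl_into_rtrancl)
qed simp

section \<open>Nested trees as arborescences in preorder\<close>

lemma nodes_conv_tree_arcs: "nodes t = root_of t # map snd (tree_arcs t)"
proof (induction t)
  case (Node x ts)
  then have "concat (map nodes ts) = concat (map (\<lambda>t. map snd ((x, root_of t) # tree_arcs t)) ts)"
    by (intro arg_cong[where f = concat] map_cong) auto
  then show ?case
    by (simp add: map_concat comp_def)
qed

lemma arborescence_tree_arcs:
  "distinct (nodes t) \<Longrightarrow> arborescence (root_of t) (tree_arcs t)"
proof (induction t)
  case (Node x ts)
  \<comment> \<open>The child list is extended at its end, matching the way an arborescence grows;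
    each step appends the arc to a child and grafts that child's subtree onto it.\<close>
  have "arborescence x (concat (map (\<lambda>t. (x, root_of t) # tree_arcs t) us))"
    if "set us \<subseteq> set ts" "distinct (x # concat (map nodes us))" for us
    using that
  proof (induction us rule: rev_induct)
    case (snoc u us)
    let ?as = "concat (map (\<lambda>t. (x, root_of t) # tree_arcs t) us)"
    have vs: "snd ` set ?as = set (concat (map nodes us))"
      by (simp add: nodes_conv_tree_arcs image_UN)
    have u: "insert (root_of u) (snd ` set (tree_arcs u)) = set (nodes u)"
      by (simp add: nodes_conv_tree_arcs)
    have dis: "set (nodes u) \<inter> insert x (snd ` set ?as) = {}" "distinct (nodes u)"
      using snoc.prems(2) unfolding vs by auto
    have "root_of u \<in> set (nodes u)"
      using u by blast
    then have "root_of u \<notin> insert x (snd ` set ?as)"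
      using dis(1) by blast
    then have 1: "arborescence x (?as @ [(x, root_of u)])"
      using snoc.IH snoc.prems by (intro arborescence.snoc) simp_all
    have 2: "arborescence (root_of u) (tree_arcs u)"
      using Node.IH[of u] snoc.prems(1) dis(2) by simp
    have vs': "snd ` set (?as @ [(x, root_of u)]) = insert (root_of u) (snd ` set ?as)"
      by simp
    have 3: "root_of u \<notin> snd ` set (tree_arcs u)"
      using dis(2) unfolding nodes_conv_tree_arcs by simp
    have 4: "A \<inter> insert x (insert r V) = {}"
      if "N \<inter> insert x V = {}" "insert r A = N" "r \<notin> A" for A V N and r :: 'a
      using that by blast
    have "arborescence x ((?as @ [(x, root_of u)]) @ tree_arcs u)"
      by (rule arborescence_append[OF 2 1]; unfold vs') (rule insertI2 insertI1 4[OF dis(1) u 3])+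
    then show ?case by simp
  qed (simp add: arborescence.Nil)
  from this[of ts] show ?case
    using Node.prems by simp
qed

lemma set_nodes: "set (nodes t) = insert (root_of t) (snd ` set (tree_arcs t))"
  by (simp add: nodes_conv_tree_arcs)

lemma length_tree_arcs: "length (tree_arcs t) \<le> length (nodes t)"
  by (simp add: nodes_conv_tree_arcs)

lemma set_children: "set (children t x) = {z. (x, z) \<in> set (tree_arcs t)}"
  by (force simp: children_def)

lemma set_parents: "set (parents t x) = {y. (y, x) \<in> set (tree_arcs t)}"
  by (force simp: parents_def)

section \<open>Subtrees and node sets that hang at a single node\<close>

definition subtree :: "'b rtree \<Rightarrow> 'b \<Rightarrow> 'b set" where
  "subtree t x = (set (tree_arcs t))\<^sup>* `` {x}"

lemma subtree_unfold: "subtree t x = insert x (\<Union>z\<in>set (children t x). subtree t z)"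
proof -
  let ?T = "set (tree_arcs t)"
  have "?T\<^sup>* = Id \<union> ?T O ?T\<^sup>*"
    using rtrancl_unfold[of ?T] r_comp_rtrancl_eq[of ?T] by simp
  then have "?T\<^sup>* `` {x} = insert x (?T\<^sup>* `` (?T `` {x}))"
    by blast
  then show ?thesis
    by (auto simp: subtree_def set_children)
qed

lemma subtree_self [simp]: "x \<in> subtree t x"
  by (simp add: subtree_def)

text \<open>Every arc across the boundary of \<open>U\<close> touches \<open>x\<close>. Whether
  \<open>x\<close> belongs to \<open>U\<close> is left open: branches beyond a neighbor exclude it,
  partial combinations at \<open>x\<close> contain it.\<close>

definition attached :: "'b rtree \<Rightarrow> 'b \<Rightarrow> 'b set \<Rightarrow> bool" where
  "attached t x U \<longleftrightarrow> (\<forall>(a, b)\<in>set (tree_arcs t). (a \<in> U \<longleftrightarrow> b \<notin> U) \<longrightarrow> a = x \<or> b = x)"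

lemma attached_singleton: "attached t x {x}"
  by (auto simp: attached_def)

lemma attached_empty: "attached t x {}"
  by (auto simp: attached_def)

lemma attached_Un: "attached t x U \<Longrightarrow> attached t x U' \<Longrightarrow> attached t x (U \<union> U')"
  by (fastforce simp: attached_def)

context
  fixes t :: "'b rtree"
  assumes distinct_nodes: "distinct (nodes t)"
begin

lemma arb: "arborescence (root_of t) (tree_arcs t)"
  using distinct_nodes by (rule arborescence_tree_arcs)

lemma tree_arcs_in_nodes: "(x, z) \<in> set (tree_arcs t) \<Longrightarrow> x \<in> set (nodes t) \<and> z \<in> set (nodes t)"
  using arborescence_Field[OF arb] unfolding set_nodes by (blast intro: FieldI1 FieldI2)

lemma distinct_targets: "distinct (root_of t # map snd (tree_arcs t))"
  using distinct_nodes nodes_conv_tree_arcs[of t] by simp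

lemma parent_unique:
  "(x, z) \<in> set (tree_arcs t) \<Longrightarrow> (y, z) \<in> set (tree_arcs t) \<Longrightarrow> x = y"
  using distinct_targets inj_onD[of snd "set (tree_arcs t)" "(x, z)" "(y, z)"]
  by (simp add: distinct_map)

lemma distinct_children: "distinct (children t x)"
  using distinct_targets distinct_map_filter[of snd "tree_arcs t"] by (simp add: children_def)

lemma parents_cases:
  assumes "x \<in> set (nodes t)"
  obtains (root) "x = root_of t" "parents t x = []"
  | (parent) y where "parents t x = [y]" "(y, x) \<in> set (tree_arcs t)"
proof (cases "parents t x")
  case Nil
  then have "x = root_of t"
    using assms set_parents[of t x] by (auto simp: set_nodes)
  then show ?thesis using Nil root by blast
next
  case (Cons y ys)
  have "distinct (map snd (tree_arcs t))" using distinct_targets by simp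
  then have "distinct (filter (\<lambda>(y, z). z = x) (tree_arcs t))"
    by (simp add: distinct_map)
  then have "distinct (parents t x)"
    unfolding parents_def by (auto simp: distinct_map inj_on_def)
  moreover have "set (parents t x) \<subseteq> {y}"
    using Cons parent_unique[of _ x y] set_parents[of t x] by (metis (mono_tags, lifting)
      list.set_intros(1) mem_Collect_eq singletonI subsetI)
  ultimately have "parents t x = [y]"
    using Cons by (cases ys) auto
  moreover have "(y, x) \<in> set (tree_arcs t)"
    using set_parents[of t x] Cons by auto
  ultimately show ?thesis using parent by blast
qed

text \<open>An earlier arc out of \<open>x\<close> would need \<open>x\<close> to be the root or an
  earlier target, against distinctness of the targets. Read backwards, the order makes the messages
  of all children available before \<open>x\<close> sends to its parent.\<close>

lemma arc_before:
  assumes "tree_arcs t = xs @ (y, x) # ys" "(x, z) \<in> set (tree_arcs t)"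
  shows "(x, z) \<in> set ys"
proof (rule ccontr)
  assume "(x, z) \<notin> set ys"
  then obtain us vs where "xs @ [(y, x)] = us @ (x, z) # vs"
    using assms by (metis Un_iff append.assoc append_Cons append_Nil set_append split_list)
  moreover from this have "tree_arcs t = us @ (x, z) # vs @ ys"
    using assms(1) by (metis append.assoc append_Cons append_Nil)
  ultimately have "x \<in> insert (root_of t) (snd ` set us)" "set us \<subseteq> set xs"
    using arborescence_source[OF arb] by (blast, cases vs rule: rev_cases) auto
  then show False
    using distinct_targets assms(1) by auto
qed

text \<open>The counterpart for the downward sweep: when a node is visited, its parent has already
  sent its message.\<close>

lemma node_before:
  assumes "nodes t = xs @ x # ys" "(y, x) \<in> set (tree_arcs t)"
  shows "y \<in> set xs"
proof -
  obtain us vs where arcs: "tree_arcs t = us @ (y, x) # vs"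
    using assms(2) by (meson split_list)
  have "nodes t = (root_of t # map snd us) @ x # map snd vs"
    using arcs by (simp add: nodes_conv_tree_arcs)
  then have "xs = root_of t # map snd us"
    using assms(1) distinct_nodes by (metis append_Cons_eq_iff distinct_append not_distinct_conv_prefix
      disjoint_iff distinct.simps(2) list.set_intros(1))
  then show ?thesis
    using arborescence_source[OF arb arcs] by auto
qed

lemma subtree_root: "subtree t (root_of t) = set (nodes t)"
proof
  have "y \<in> set (nodes t)" if "(root_of t, y) \<in> (set (tree_arcs t))\<^sup>*" for y
    using that tree_arcs_in_nodes by (cases rule: rtranclE) (auto simp: set_nodes)
  then show "subtree t (root_of t) \<subseteq> set (nodes t)"
    by (auto simp: subtree_def)
  show "set (nodes t) \<subseteq> subtree t (root_of t)"
    using arborescence_reach[OF arb] by (auto simp: subtree_def set_nodes)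
qed

lemma subtree_subset:
  assumes "x \<in> set (nodes t)"
  shows "subtree t x \<subseteq> set (nodes t)"
proof -
  have "(root_of t, x) \<in> (set (tree_arcs t))\<^sup>*"
    using assms subtree_root by (auto simp: subtree_def)
  then have "subtree t x \<subseteq> subtree t (root_of t)"
    by (auto simp: subtree_def)
  then show ?thesis by (simp add: subtree_root)
qed

lemma parent_notin_subtree:
  assumes "(x, z) \<in> set (tree_arcs t)"
  shows "x \<notin> subtree t z"
  using assms arborescence_acyclic[OF arb]
  by (auto simp: subtree_def acyclic_def dest: rtrancl_into_trancl1)

text \<open>Parents are unique, so two nodes with a common descendant are comparable. A path between
  two siblings would have to enter the second one through \<open>x\<close>, contradicting
  acyclicity.\<close>

lemma subtree_disjoint:
  assumes "(x, z) \<in> set (tree_arcs t)" "(x, z') \<in> set (tree_arcs t)" "z \<noteq> z'"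
  shows "subtree t z \<inter> subtree t z' = {}"
proof -
  have no_path: "(z1, z2) \<notin> (set (tree_arcs t))\<^sup>*"
    if z: "(x, z1) \<in> set (tree_arcs t)" "(x, z2) \<in> set (tree_arcs t)" "z1 \<noteq> z2" for z1 z2
  proof
    assume "(z1, z2) \<in> (set (tree_arcs t))\<^sup>*"
    then obtain y where "(z1, y) \<in> (set (tree_arcs t))\<^sup>*" "(y, z2) \<in> set (tree_arcs t)"
      using z(3) by (meson rtranclE)
    moreover from this have "y = x" using parent_unique z(2) by blast
    ultimately show False
      using parent_notin_subtree[OF z(1)] by (simp add: subtree_def)
  qed
  have sv: "single_valued ((set (tree_arcs t))\<inverse>)"
    using parent_unique by (auto simp: single_valued_def)
  have False if "(z, b) \<in> (set (tree_arcs t))\<^sup>*" "(z', b) \<in> (set (tree_arcs t))\<^sup>*" for b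
    using single_valued_confluent[OF sv, of b z z'] that no_path[of z z'] no_path[of z' z] assms
    by (auto simp: rtrancl_converse)
  then show ?thesis
    by (auto simp: subtree_def)
qed

text \<open>The arc \<open>(x, z)\<close> is the only one crossing the boundary. Both endpoints are
  recorded because handing a message over needs attachment at the sender, for the separation
  argument, and at the receiver, for further combinations.\<close>

lemma attached_subtree:
  assumes "(x, z) \<in> set (tree_arcs t)"
  shows "attached t x (subtree t z)" "attached t z (subtree t z)"
proof -
  have "(a, b) = (x, z)"
    if "(a, b) \<in> set (tree_arcs t)" "a \<in> subtree t z \<longleftrightarrow> b \<notin> subtree t z" for a b
  proof -
    have ab: "a \<notin> subtree t z" "b \<in> subtree t z"
      using that unfolding subtree_def by (metis Image_singleton_iff rtrancl_into_rtrancl)+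
    have "b = z"
    proof (rule ccontr)
      assume "b \<noteq> z"
      then obtain y where "(z, y) \<in> (set (tree_arcs t))\<^sup>*" "(y, b) \<in> set (tree_arcs t)"
        using ab(2) unfolding subtree_def by (metis Image_singleton_iff rtranclE)
      then show False
        using parent_unique[OF that(1)] ab(1) by (auto simp: subtree_def)
    qed
    then show ?thesis using that(1) parent_unique assms by blast
  qed
  then show "attached t x (subtree t z)" "attached t z (subtree t z)"
    unfolding attached_def by blast+
qed

lemma attached_complement:
  assumes "attached t x U"
  shows "attached t x (set (nodes t) - U)"
  using assms tree_arcs_in_nodes unfolding attached_def by blast

text \<open>Each arc is counted once, at its source. This amortization makes the total cost of the
  sweeps linear in the number of nodes, whatever the degrees.\<close>

lemma sum_length_children: "(\<Sum>x\<leftarrow>nodes t. length (children t x)) = length (tree_arcs t)"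
proof -
  have "(\<Sum>x\<leftarrow>nodes t. length (filter (\<lambda>(y, z). y = x) as)) = length as"
    if "fst ` set as \<subseteq> set (nodes t)" for as :: "('b \<times> 'b) list"
    using that
  proof (induction as)
    case (Cons a as)
    have "(\<Sum>x\<leftarrow>nodes t. length (filter (\<lambda>(y, z). y = x) (a # as))) =
        (\<Sum>x\<leftarrow>nodes t. of_bool (fst a = x)) + (\<Sum>x\<leftarrow>nodes t. length (filter (\<lambda>(y, z). y = x) as))"
      by (simp flip: sum_list_addf add: case_prod_beta) (intro arg_cong[of _ _ sum_list] map_cong, auto)
    moreover have "(\<Sum>x\<leftarrow>nodes t. of_bool (fst a = x)) = (1::nat)"
      using Cons.prems distinct_nodes by (simp add: sum_list_distinct_conv_sum_set)
    ultimately show ?case using Cons by simp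
  qed simp
  moreover have "fst ` set (tree_arcs t) \<subseteq> set (nodes t)"
    using tree_arcs_in_nodes by force
  ultimately show ?thesis
    by (simp add: children_def)
qed

end

text \<open>A walk inside \<open>X\<close> from \<open>a\<close> to \<open>b\<close> has to leave
  \<open>U\<close> somewhere, and the arc by which it leaves has \<open>x\<close> as an
  endpoint.\<close>

lemma attached_separates:
  assumes "attached t x U" "connected_in t X" "a \<in> X \<inter> U" "b \<in> X - U"
  shows "x \<in> X"
proof -
  let ?r = "(set (tree_arcs t) \<union> (set (tree_arcs t))\<inverse>) \<inter> X \<times> X"
  have "(a, b) \<in> ?r\<^sup>*"
    using assms(2-4) unfolding connected_in_def by blast
  then have "b \<notin> U \<longrightarrow> (\<exists>(c, d)\<in>?r. c \<in> U \<and> d \<notin> U)"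
    by (induction rule: rtrancl_induct) (use assms(3) in blast)+
  then show ?thesis
    using assms(1,4) unfolding attached_def by blast
qed

section \<open>Reasoning about compilers\<close>

definition extends :: "'a gate list \<Rightarrow> 'a gate list \<Rightarrow> bool" where
  "extends c c' \<longleftrightarrow> prefix c c' \<and> wf_circuit c'"

text \<open>A Hoare triple; \<open>g\<close> bounds the gates emitted and \<open>h\<close> the operations charged.\<close>

definition spec ::
    "nat \<Rightarrow> nat \<Rightarrow> ('a, 'r) compiler \<Rightarrow> ('r \<Rightarrow> 'a gate list \<Rightarrow> bool) \<Rightarrow> 'a gate list \<Rightarrow> bool" where
  "spec g h m Q c \<longleftrightarrow> (\<forall>k r c' k'. run_state m (c, k) = (r, c', k') \<longrightarrow>
     extends c c' \<and> length c' \<le> length c + g \<and> k' \<le> k + h \<and> Q r c')"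

lemma extends_trans: "extends c c' \<Longrightarrow> extends c' c'' \<Longrightarrow> extends c c''"
  by (auto simp: extends_def)

lemma extends_refl: "wf_circuit c \<Longrightarrow> extends c c"
  by (simp add: extends_def)

lemma extends_length: "extends c c' \<Longrightarrow> i < length c \<Longrightarrow> i < length c'"
  by (auto simp: extends_def dest: prefix_length_le)

lemma extends_wf: "extends c c' \<Longrightarrow> wf_circuit c'"
  by (simp add: extends_def)

lemma extends_gate_value:
  "extends c c' \<Longrightarrow> i < length c \<Longrightarrow> gate_value c' \<theta> i = gate_value c \<theta> i"
  by (simp add: extends_def gate_value_prefix)

lemma spec_return: "wf_circuit c \<Longrightarrow> Q r c \<Longrightarrow> spec 0 0 (State_Monad.return r) Q c"
  by (simp add: spec_def extends_refl)

lemma spec_weaken: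
  assumes "spec g h m Q c" "g \<le> g'" "h \<le> h'"
    and "\<And>r c'. extends c c' \<Longrightarrow> Q r c' \<Longrightarrow> Q' r c'"
  shows "spec g' h' m Q' c"
  unfolding spec_def
proof (intro allI impI)
  fix k r c' k' assume "run_state m (c, k) = (r, c', k')"
  then have "extends c c'" "length c' \<le> length c + g" "k' \<le> k + h" "Q r c'"
    using assms(1) unfolding spec_def by blast+
  then show "extends c c' \<and> length c' \<le> length c + g' \<and> k' \<le> k + h' \<and> Q' r c'"
    using assms(2-4) by auto
qed

lemma spec_bind:
  assumes "spec g1 h1 m Q1 c"
    and "\<And>r c'. extends c c' \<Longrightarrow> Q1 r c' \<Longrightarrow> spec g2 h2 (f r) Q c'"
  shows "spec (g1 + g2) (h1 + h2) (State_Monad.bind m f) Q c"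
  unfolding spec_def
proof (intro allI impI)
  fix k r c' k' assume run: "run_state (State_Monad.bind m f) (c, k) = (r, c', k')"
  obtain r1 c1 k1 where m: "run_state m (c, k) = (r1, c1, k1)"
    by (metis prod_cases3)
  then have 1: "extends c c1" "length c1 \<le> length c + g1" "k1 \<le> k + h1" "Q1 r1 c1"
    using assms(1) unfolding spec_def by blast+
  have "run_state (f r1) (c1, k1) = (r, c', k')"
    using run m by simp
  then have "extends c1 c'" "length c' \<le> length c1 + g2" "k' \<le> k1 + h2" "Q r c'"
    using assms(2)[OF 1(1,4)] unfolding spec_def by blast+
  then show "extends c c' \<and> length c' \<le> length c + (g1 + g2) \<and> k' \<le> k + (h1 + h2) \<and> Q r c'"
    using 1 extends_trans by fastforce
qed

lemma spec_emit:
  assumes "wf_circuit c" "operands g \<subseteq> {..<length c}"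
  shows "spec 1 0 (emit g) (\<lambda>i c'. i = length c \<and> c' = c @ [g]) c"
  using assms by (auto simp: spec_def emit_def extends_def)

lemma spec_charge: "wf_circuit c \<Longrightarrow> spec 0 m (charge m) (\<lambda>_ c'. c' = c) c"
  by (auto simp: spec_def charge_def extends_def)

text \<open>The invariant sees the processed prefix, and its preservation may use the entire split
  of the list: in the sweeps, which messages are ready depends on the position in the
  traversal.\<close>

lemma spec_foldM:
  assumes "wf_circuit c" "I [] r c"
    and "\<And>ys y zs r c'. xs = ys @ y # zs \<Longrightarrow> extends c c' \<Longrightarrow> I ys r c' \<Longrightarrow>
      spec (g y) (h y) (f y r) (I (ys @ [y])) c'"
  shows "spec (\<Sum>x\<leftarrow>xs. g x) (\<Sum>x\<leftarrow>xs. h x) (foldM f xs r) (I xs) c"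
proof -
  have "spec (\<Sum>x\<leftarrow>zs. g x) (\<Sum>x\<leftarrow>zs. h x) (foldM f zs r) (I xs) c'"
    if "xs = ys @ zs" "extends c c'" "I ys r c'" for ys zs r c'
    using that
  proof (induction zs arbitrary: ys r c')
    case Nil
    then show ?case by (simp add: spec_return extends_wf)
  next
    case (Cons z zs)
    have "spec (g z + (\<Sum>x\<leftarrow>zs. g x)) (h z + (\<Sum>x\<leftarrow>zs. h x))
        (State_Monad.bind (f z r) (\<lambda>r. foldM f zs r)) (I xs) c'"
    proof (rule spec_bind[OF assms(3)[OF Cons.prems]])
      fix r' c'' assume "extends c' c''" "I (ys @ [z]) r' c''"
      then show "spec (\<Sum>x\<leftarrow>zs. g x) (\<Sum>x\<leftarrow>zs. h x) (foldM f zs r') (I xs) c''"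
        using Cons.prems by (intro Cons.IH[of "ys @ [z]"]) (auto intro: extends_trans)
    qed
    then show ?case by simp
  qed
  from this[of "[]" xs c r] show ?thesis
    using assms(1,2) by (simp add: extends_refl)
qed

lemma enum:
  assumes "finite A"
  shows "distinct (enum A)" "set (enum A) = A"
  using someI_ex[OF finite_distinct_list[OF assms, unfolded conj_commute[of "set _ = _"]]]
  unfolding enum_def by auto

lemma length_enum: "finite A \<Longrightarrow> length (enum A) = card A"
  using enum[of A] by (metis distinct_card)

section \<open>Compiled distributions\<close>

definition dist_ok :: "'a option set \<Rightarrow> 'a gate list \<Rightarrow> 'a dist \<Rightarrow> bool" where
  "dist_ok X c D \<longleftrightarrow>
     distinct (map fst D) \<and> fst ` set D \<subseteq> Pow (X \<times> X) \<and> snd ` set D \<subseteq> {..<length c}"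

text \<open>The integral of \<open>f\<close> against \<open>D\<close>, with gate values as masses
  that may be negative.\<close>

definition mass ::
    "'a gate list \<Rightarrow> ('a \<Rightarrow> real) \<Rightarrow> ('a option rel \<Rightarrow> real) \<Rightarrow> 'a dist \<Rightarrow> real" where
  "mass c \<theta> f D = (\<Sum>(R, i)\<leftarrow>D. gate_value c \<theta> i * f R)"

text \<open>
  \<open>D\<close> is the distribution of \<open>s L\<close> where \<open>L\<close> is the set of live edges among \<open>A\<close>. Integrating arbitrary
  functions turns the combination of independent distributions into an iterated integral.
\<close>

definition law ::
    "('a \<times> 'a \<Rightarrow> real) \<Rightarrow> 'a option set \<Rightarrow> 'a gate list \<Rightarrow> 'a option rel
       \<Rightarrow> ('a option rel \<Rightarrow> 'a option rel) \<Rightarrow> 'a dist \<Rightarrow> bool" where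
  "law p X c A s D \<longleftrightarrow> dist_ok X c D \<and>
     (\<forall>\<theta> f. mass c \<theta> f D = expect (edge_weight p \<theta>) A (\<lambda>L. f (s L)))"

lemma dist_ok_extends: "dist_ok X c D \<Longrightarrow> extends c c' \<Longrightarrow> dist_ok X c' D"
  unfolding dist_ok_def using extends_length by blast

lemma mass_extends:
  assumes "dist_ok X c D" "extends c c'"
  shows "mass c' \<theta> f D = mass c \<theta> f D"
  unfolding mass_def using assms extends_gate_value[OF assms(2)]
  by (intro arg_cong[where f = sum_list] map_cong) (auto simp: dist_ok_def)

lemma law_extends: "law p X c A s D \<Longrightarrow> extends c c' \<Longrightarrow> law p X c' A s D"
  by (auto simp: law_def dist_ok_extends mass_extends)

lemma law_mono: "law p X c A s D \<Longrightarrow> X \<subseteq> X' \<Longrightarrow> law p X' c A s D"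
  by (fastforce simp: law_def dist_ok_def)

lemma dist_ok_length:
  assumes "dist_ok X c D" "finite X" "card X \<le> d"
  shows "length D \<le> 2 ^ d\<^sup>2"
proof -
  have "length D = card (fst ` set D)"
    using assms(1) distinct_card[of "map fst D"] by (simp add: dist_ok_def)
  also have "\<dots> \<le> card (Pow (X \<times> X))"
    using assms(1,2) by (intro card_mono) (auto simp: dist_ok_def)
  also have "\<dots> = 2 ^ (card X)\<^sup>2"
    using assms(2) by (simp add: card_Pow card_cartesian_product power2_eq_square)
  also have "\<dots> \<le> 2 ^ d\<^sup>2"
    using assms(3) by (intro power_increasing power_mono) auto
  finally show ?thesis .
qed

lemma mass_update:
  assumes "distinct (map fst D)" "map_of D R = Some j"
  shows "mass c \<theta> f (AList.update R k D) =
    mass c \<theta> f D + (gate_value c \<theta> k - gate_value c \<theta> j) * f R"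
  using assms
proof (induction D)
  case (Cons x D)
  then show ?case
    by (cases x) (auto simp: mass_def algebra_simps split: if_splits)
qed simp

lemma spec_accumulate:
  assumes "wf_circuit c" "dist_ok X c D" "i < length c" "R \<subseteq> X \<times> X"
  shows "spec 1 0 (accumulate R i D)
    (\<lambda>D' c'. dist_ok X c' D' \<and> (\<forall>\<theta> f. mass c' \<theta> f D' = mass c \<theta> f D + gate_value c \<theta> i * f R)) c"
proof (cases "map_of D R")
  case None
  then have "dist_ok X c (D @ [(R, i)])"
    using assms by (auto simp: dist_ok_def map_of_eq_None_iff)
  then have "spec 0 0 (State_Monad.return (D @ [(R, i)]))
    (\<lambda>D' c'. dist_ok X c' D' \<and> (\<forall>\<theta> f. mass c' \<theta> f D' = mass c \<theta> f D + gate_value c \<theta> i * f R)) c"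
    using assms(1) by (intro spec_return) (auto simp: mass_def)
  then show ?thesis
    using None by (auto simp: accumulate_def intro: spec_weaken)
next
  case (Some j)
  then have j: "j < length c"
    using assms(2) map_of_SomeD[OF Some] by (force simp: dist_ok_def)
  have "spec (1 + 0) (0 + 0)
    (State_Monad.bind (emit (Add j i)) (\<lambda>k. State_Monad.return (AList.update R k D)))
    (\<lambda>D' c'. dist_ok X c' D' \<and> (\<forall>\<theta> f. mass c' \<theta> f D' = mass c \<theta> f D + gate_value c \<theta> i * f R)) c"
  proof (rule spec_bind[OF spec_emit])
    fix k c' assume ext: "extends c c'" and k: "k = length c \<and> c' = c @ [Add j i]"
    have "gate_value c' \<theta> k = gate_value c \<theta> j + gate_value c \<theta> i" for \<theta>
      using k by (simp del: forward_snoc)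
    then have "mass c' \<theta> f (AList.update R k D) = mass c \<theta> f D + gate_value c \<theta> i * f R" for \<theta> f
      using assms(2) Some ext j extends_gate_value[OF ext j]
      by (subst mass_update) (auto simp: mass_extends dist_ok_def)
    moreover have "dist_ok X c' (AList.update R k D)"
    proof -
      have sub: "fst ` set (AList.update R k D) \<subseteq> insert R (fst ` set D)"
        "snd ` set (AList.update R k D) \<subseteq> insert k (snd ` set D)"
        by (induction D) auto
      have "insert R (fst ` set D) \<subseteq> Pow (X \<times> X)" "insert k (snd ` set D) \<subseteq> {..<length c'}"
        using assms(4) k dist_ok_extends[OF assms(2) ext] by (simp_all add: dist_ok_def)
      then show ?thesis
        unfolding dist_ok_def using assms(2) sub[THEN subset_trans]
        by (simp add: dist_ok_def distinct_update)
    qed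
    ultimately show "spec 0 0 (State_Monad.return (AList.update R k D))
      (\<lambda>D' c'. dist_ok X c' D' \<and> (\<forall>\<theta> f. mass c' \<theta> f D' = mass c \<theta> f D + gate_value c \<theta> i * f R)) c'"
      using ext by (intro spec_return) (auto intro: extends_wf)
  qed (use assms j in auto)
  then show ?thesis
    using Some by (simp add: accumulate_def)
qed

text \<open>Each pair of states costs at most two gates: a product, and an addition if the resulting
  relation is already listed.\<close>

lemma spec_combine:
  assumes "wf_circuit c" "dist_ok X1 c D1" "dist_ok X2 c D2"
  shows "spec (2 * (length D1 * length D2)) (card X ^ 3 * (length D1 * length D2)) (combine X Y D1 D2)
    (\<lambda>D c'. dist_ok Y c' D \<and> (\<forall>\<theta> f. mass c' \<theta> f D =
       mass c \<theta> (\<lambda>R1. mass c \<theta> (\<lambda>R2. f (reach_rel Y (R1 \<union> R2))) D2) D1)) c"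
proof -
  define I :: "(('a option rel \<times> nat) \<times> 'a option rel \<times> nat) list \<Rightarrow> 'a dist \<Rightarrow> 'a gate list \<Rightarrow> bool"
    where "I ps D c' \<longleftrightarrow> dist_ok Y c' D \<and> (\<forall>\<theta> f. mass c' \<theta> f D =
      (\<Sum>((R1, i), (R2, j))\<leftarrow>ps. gate_value c \<theta> i * gate_value c \<theta> j * f (reach_rel Y (R1 \<union> R2))))"
    for ps D c'
  let ?f = "\<lambda>((R1, i), (R2, j)) D. do {
        charge (card X ^ 3);
        k \<leftarrow> emit (Mul i j);
        accumulate (reach_rel Y (R1 \<union> R2)) k D
      }"
  have "spec (\<Sum>x\<leftarrow>List.product D1 D2. 2) (\<Sum>x\<leftarrow>List.product D1 D2. card X ^ 3)
    (combine X Y D1 D2) (I (List.product D1 D2)) c"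
    unfolding combine_def
  proof (rule spec_foldM)
    show "I [] [] c"
      by (simp add: I_def dist_ok_def mass_def)
    fix ys y zs D c'
    assume split: "List.product D1 D2 = ys @ y # zs" and ext: "extends c c'" and I: "I ys D c'"
    obtain R1 i R2 j where y: "y = ((R1, i), (R2, j))"
      by (metis prod.exhaust)
    have "y \<in> set (List.product D1 D2)"
      using split by simp
    then have "(R1, i) \<in> set D1" "(R2, j) \<in> set D2"
      using y by auto
    then have ij: "i < length c" "j < length c"
      using assms(2,3) by (force simp: dist_ok_def)+
    have "spec (0 + (1 + 1)) (card X ^ 3 + (0 + 0)) (?f y D) (I (ys @ [y])) c'"
      unfolding y prod.case
    proof (rule spec_bind[OF spec_charge], goal_cases)
      case (2 _ c1)
      then have [simp]: "c1 = c'" by simp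
      show ?case
      proof (rule spec_bind[OF spec_emit], goal_cases)
        case 2
        then show ?case using ij ext extends_length by auto
      next
        case (3 k c2)
        have k: "gate_value c2 \<theta> k = gate_value c \<theta> i * gate_value c \<theta> j" "k < length c2" for \<theta>
          using 3(2) ij ext by (auto simp: extends_gate_value simp del: forward_snoc)
        have c2: "extends c' c2" using 3 by simp
        have "reach_rel Y (R1 \<union> R2) \<subseteq> Y \<times> Y"
          by (auto simp: reach_rel_def)
        moreover have "dist_ok Y c2 D"
          using I c2 dist_ok_extends by (auto simp: I_def)
        ultimately show ?case
        proof (intro spec_weaken[OF spec_accumulate])
          fix D' c3
          assume "dist_ok Y c3 D' \<and> (\<forall>\<theta> f. mass c3 \<theta> f D' =
            mass c2 \<theta> f D + gate_value c2 \<theta> k * f (reach_rel Y (R1 \<union> R2)))"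
          then show "I (ys @ [((R1, i), R2, j)]) D' c3"
            using I c2 k(1) by (auto simp: I_def mass_extends)
        qed (use k(2) c2 extends_wf in auto)
      qed (use ext extends_wf in auto)
    qed (use ext extends_wf in auto)
    then show "spec 2 (card X ^ 3) (?f y D) (I (ys @ [y])) c'"
      by (simp add: numeral_2_eq_2)
  qed (use assms in auto)
  moreover have "(\<Sum>((R1, i), (R2, j))\<leftarrow>List.product D1 D2.
      gate_value c \<theta> i * gate_value c \<theta> j * f (reach_rel Y (R1 \<union> R2))) =
    mass c \<theta> (\<lambda>R1. mass c \<theta> (\<lambda>R2. f (reach_rel Y (R1 \<union> R2))) D2) D1" for \<theta> f
    by (induction D1)
      (auto simp: mass_def sum_list_const_mult[symmetric] case_prod_beta comp_def mult.assoc)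
  ultimately show ?thesis
    by (elim spec_weaken) (auto simp: I_def sum_list_triv length_product)
qed

definition combine_gates :: "nat \<Rightarrow> nat" where
  "combine_gates d = 2 * (2 ^ d\<^sup>2 * 2 ^ d\<^sup>2)"

definition combine_ops :: "nat \<Rightarrow> nat" where
  "combine_ops d = d ^ 3 * (2 ^ d\<^sup>2 * 2 ^ d\<^sup>2)"

text \<open>The maps \<open>s1\<close>, \<open>s2\<close> and \<open>s\<close> are left open so that
  the lemma covers both the combination of reachability relations and the insertion of a single raw
  edge, for which \<open>s2\<close> is the identity.\<close>

lemma spec_combine_law:
  assumes "wf_circuit c" "finite X" "card X \<le> d"
    and "law p X c A1 s1 D1" "law p X c A2 s2 D2"
    and "finite A1" "finite A2" "A1 \<inter> A2 = {}"
    and "\<And>L1 L2. L1 \<subseteq> A1 \<Longrightarrow> L2 \<subseteq> A2 \<Longrightarrow> reach_rel Y (s1 L1 \<union> s2 L2) = s (L1 \<union> L2)"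
  shows "spec (combine_gates d) (combine_ops d) (combine X Y D1 D2)
    (\<lambda>D c'. law p Y c' (A1 \<union> A2) s D) c"
proof -
  have ok: "dist_ok X c D1" "dist_ok X c D2"
    using assms by (auto simp: law_def)
  have len: "length D1 * length D2 \<le> 2 ^ d\<^sup>2 * 2 ^ d\<^sup>2"
    using dist_ok_length[OF ok(1)] dist_ok_length[OF ok(2)] assms by (intro mult_le_mono) auto
  have "mass c \<theta> (\<lambda>R1. mass c \<theta> (\<lambda>R2. f (reach_rel Y (R1 \<union> R2))) D2) D1 =
      expect (edge_weight p \<theta>) (A1 \<union> A2) (\<lambda>L. f (s L))" for \<theta> f
  proof -
    have "mass c \<theta> (\<lambda>R1. mass c \<theta> (\<lambda>R2. f (reach_rel Y (R1 \<union> R2))) D2) D1 =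
        expect (edge_weight p \<theta>) A1 (\<lambda>L1. expect (edge_weight p \<theta>) A2
          (\<lambda>L2. f (reach_rel Y (s1 L1 \<union> s2 L2))))"
      using assms(4,5) by (simp add: law_def)
    also have "\<dots> = expect (edge_weight p \<theta>) A1 (\<lambda>L1. expect (edge_weight p \<theta>) A2
          (\<lambda>L2. f (s (L1 \<union> L2))))"
      using assms(9) by (intro expect_cong) auto
    also have "\<dots> = expect (edge_weight p \<theta>) (A1 \<union> A2) (\<lambda>L. f (s L))"
      using assms(6-8) by (rule expect_Un[symmetric])
    finally show ?thesis .
  qed
  then show ?thesis
    using len assms(3)
    by (intro spec_weaken[OF spec_combine[OF assms(1) ok]])
      (auto simp: law_def combine_gates_def combine_ops_def intro!: mult_le_mono power_mono)
qed

lemma spec_unit_dist: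
  assumes "wf_circuit c"
  shows "spec 1 0 (unit_dist X) (\<lambda>D c'. law p X c' {} (reach_rel X) D) c"
proof -
  have "spec (1 + 0) (0 + 0) (unit_dist X) (\<lambda>D c'. law p X c' {} (reach_rel X) D) c"
    unfolding unit_dist_def
  proof (rule spec_bind[OF spec_emit], goal_cases)
    case (3 i c')
    then have "gate_value c' \<theta> i = 1" "i < length c'" for \<theta>
      by (auto simp del: forward_snoc)
    moreover have "Id_on X = reach_rel X {}"
      by (auto simp: reach_rel_def)
    moreover have "reach_rel X {} \<subseteq> X \<times> X"
      by (auto simp: reach_rel_def)
    ultimately have "law p X c' {} (reach_rel X) [(Id_on X, i)]"
      by (simp add: law_def dist_ok_def mass_def)
    then show ?case
      using 3 assms by (intro spec_return) (auto simp: extends_wf)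
  qed (use assms in auto)
  then show ?thesis by simp
qed

lemma spec_edge_dist:
  assumes "wf_circuit c" "e \<in> X \<times> X"
  shows "spec 5 0 (edge_dist p e) (\<lambda>D c'. law p X c' {e} (\<lambda>L. L) D) c"
proof -
  let ?g = "edge_gate p e"
  \<comment> \<open>The complement probability is computed as \<open>1 + (- 1) * live\<close>, since
    gates only add and multiply; the last of the five gates, at position
    \<open>length c + 4\<close>, holds it.\<close>
  let ?gs = "[?g, Con 1, Con (- 1), Mul (length c + 2) (length c), Add (length c + 1) (length c + 3)]"
  have ops: "operands ?g = {}"
    by (cases "(p, e)" rule: edge_gate.cases) auto
  have val: "gate_value (c @ [?g]) \<theta> (length c) = edge_weight p \<theta> e" for \<theta>
    by (cases "(p, e)" rule: edge_gate.cases) (auto simp del: forward_snoc)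
  let ?c = "c @ ?gs"
  have wf: "wf_circuit ?c"
  proof -
    have "wf_circuit (((((c @ [?g]) @ [Con 1]) @ [Con (- 1)]) @ [Mul (length c + 2) (length c)])
        @ [Add (length c + 1) (length c + 3)])"
      unfolding wf_circuit_snoc using assms(1) ops by simp
    then show ?thesis by simp
  qed
  have vals: "gate_value ?c \<theta> (length c) = edge_weight p \<theta> e"
    "gate_value ?c \<theta> (length c + 4) = 1 - edge_weight p \<theta> e" for \<theta>
  proof -
    define c1 where "c1 = c @ [?g]"
    define c2 where "c2 = c1 @ [Con 1]"
    define c3 where "c3 = c2 @ [Con (- 1)]"
    define c4 where "c4 = c3 @ [Mul (length c + 2) (length c)]"
    define c5 where "c5 = c4 @ [Add (length c + 1) (length c + 3)]"
    have len: "length c1 = length c + 1" "length c2 = length c + 2" "length c3 = length c + 3"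
      "length c4 = length c + 4"
      by (simp_all add: c1_def c2_def c3_def c4_def)
    have pre: "prefix c1 c3" "prefix c2 c4" "prefix c1 c5" "prefix c3 c4"
      by (simp_all add: c1_def c2_def c3_def c4_def c5_def)
    have 1: "gate_value c1 \<theta> (length c) = edge_weight p \<theta> e"
      using val by (simp add: c1_def)
    have 2: "gate_value c2 \<theta> (length c + 1) = 1"
      unfolding c2_def len(1)[symmetric] gate_value_snoc by simp
    have 3: "gate_value c3 \<theta> (length c + 2) = - 1"
      unfolding c3_def len(2)[symmetric] gate_value_snoc by simp
    have 4: "gate_value c4 \<theta> (length c + 3) = - edge_weight p \<theta> e"
      using 3 1 gate_value_prefix[OF pre(1), of "length c" \<theta>] len
      unfolding c4_def len(3)[symmetric] gate_value_snoc by simp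
    have 5: "gate_value c5 \<theta> (length c + 4) = 1 - edge_weight p \<theta> e"
      using 4 2 gate_value_prefix[OF pre(2), of "length c + 1" \<theta>] len
      unfolding c5_def len(4)[symmetric] gate_value_snoc by simp
    have "?c = c5"
      by (simp add: c1_def c2_def c3_def c4_def c5_def)
    then show "gate_value ?c \<theta> (length c) = edge_weight p \<theta> e"
      "gate_value ?c \<theta> (length c + 4) = 1 - edge_weight p \<theta> e"
      using 5 1 gate_value_prefix[OF pre(3), of "length c" \<theta>] len by simp_all
  qed
  have run: "run_state (edge_dist p e) (c, k) = ([({e}, length c), ({}, length c + 4)], ?c, k)" for k
    by (simp add: edge_dist_def emit_def)
  have "law p X ?c {e} (\<lambda>L. L) [({e}, length c), ({}, length c + 4)]"
    using assms(2) vals by (auto simp: law_def dist_ok_def mass_def expect_singleton)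
  then show ?thesis
    using wf by (auto simp: spec_def run extends_def)
qed

lemma spec_sum_gates:
  assumes "wf_circuit c" "set is \<subseteq> {..<length c}"
  shows "spec (1 + length is) 0 (sum_gates is)
    (\<lambda>i c'. i < length c' \<and> (\<forall>\<theta>. gate_value c' \<theta> i = (\<Sum>j\<leftarrow>is. gate_value c \<theta> j))) c"
proof -
  define I where "I js s c' \<longleftrightarrow> s < length c' \<and> (\<forall>\<theta>. gate_value c' \<theta> s = (\<Sum>j\<leftarrow>js. gate_value c \<theta> j))"
    for js s c'
  have "spec (1 + (\<Sum>i\<leftarrow>is. 1)) (0 + (\<Sum>i\<leftarrow>is. 0)) (sum_gates is) (I is) c"
    unfolding sum_gates_def
  proof (rule spec_bind[OF spec_emit], goal_cases)
    case (3 z c1)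
    show ?case
    proof (rule spec_foldM)
      show "I [] z c1"
        using 3 by (auto simp: I_def simp del: forward_snoc)
      fix js j ks s c2
      assume is_eq: "is = js @ j # ks" and c2: "extends c1 c2" and s: "I js s c2"
      have j: "j < length c" using assms(2) is_eq by simp
      have ext: "extends c c2" using 3(1) c2 by (rule extends_trans)
      have j2: "j < length c2" by (rule extends_length[OF ext j])
      show "spec 1 0 (emit (Add s j)) (I (js @ [j])) c2"
      proof (rule spec_weaken[OF spec_emit[OF extends_wf[OF c2]]])
        show "operands (Add s j) \<subseteq> {..<length c2}"
          using s j2 by (simp add: I_def)
        show "I (js @ [j]) r c'" if "r = length c2 \<and> c' = c2 @ [Add s j]" for r c'
          using that s extends_gate_value[OF ext j] by (simp add: I_def del: forward_snoc)
      qed auto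
    qed (rule extends_wf[OF 3(1)])
  qed (use assms in auto)
  then show ?thesis
    by (simp add: I_def[abs_def] sum_list_triv)
qed

section \<open>Correctness and cost of the sweeps\<close>

text \<open>\<open>d\<close> bounds the size of the extended bags, where the extra 1 stands for
  \<open>None\<close>. As a free parameter it keeps the truncated subtraction in
  \<open>width\<close> out of the analysis.\<close>

locale decomposed_graph = pair_fin_digraph G for G :: "'a pair_pre_digraph" +
  fixes p :: "'a \<times> 'a \<Rightarrow> real" and t :: "'b rtree" and B :: "'b \<Rightarrow> 'a set"
    and own :: "'a option \<times> 'a option \<Rightarrow> 'b" and rd :: "'a \<Rightarrow> 'b" and d :: nat
  assumes decomposition: "tree_decomposition G t B"
    and owner: "owner_assignment G t B own"
    and readout: "readout_assignment G t B rd"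
    and bag_size: "x \<in> set (nodes t) \<Longrightarrow> card (B x) + 1 \<le> d"
begin

abbreviation bag :: "'b \<Rightarrow> 'a option set" where
  "bag \<equiv> ext_bag B"

section \<open>Edges owned by sets of nodes, and separation by bags\<close>

definition edges :: "'b set \<Rightarrow> 'a option rel" where
  "edges U = {e \<in> extended_edges G. own e \<in> U}"

lemma distinct_nodes: "distinct (nodes t)"
  using decomposition by (simp add: tree_decomposition_def)

lemma bag_connected: "v \<in> pverts G \<Longrightarrow> connected_in t {x \<in> set (nodes t). v \<in> B x}"
  using decomposition by (simp add: tree_decomposition_def)

lemma bag_subset: "x \<in> set (nodes t) \<Longrightarrow> B x \<subseteq> pverts G"
  using decomposition by (simp add: tree_decomposition_def)

lemma finite_bag: "x \<in> set (nodes t) \<Longrightarrow> finite (bag x)"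
  using bag_subset finite_subset[OF _ pair_finite_verts] by (auto simp: ext_bag_def)

lemma card_bag:
  assumes "x \<in> set (nodes t)"
  shows "card (bag x) \<le> d"
proof -
  have "finite (B x)"
    using bag_subset[OF assms] pair_finite_verts by (rule finite_subset)
  then have "card (bag x) = card (B x) + 1"
    by (simp add: ext_bag_def card_image)
  then show ?thesis
    using bag_size[OF assms] by simp
qed

lemma None_in_bag [simp]: "None \<in> bag x"
  by (simp add: ext_bag_def)

lemma Some_in_bag [simp]: "Some v \<in> bag x \<longleftrightarrow> v \<in> B x"
  by (auto simp: ext_bag_def)

lemma finite_edges [simp]: "finite (edges U)"
  using finite_extended_edges[of G] pair_fin_digraph_axioms by (simp add: edges_def)

lemma edges_empty [simp]: "edges {} = {}"
  by (simp add: edges_def)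

lemma edges_Un: "edges (U \<union> U') = edges U \<union> edges U'"
  by (auto simp: edges_def)

lemma edges_disjoint: "U \<inter> U' = {} \<Longrightarrow> edges U \<inter> edges U' = {}"
  by (auto simp: edges_def)

lemma edge_in_bag: "(u, v) \<in> extended_edges G \<Longrightarrow>
    own (u, v) \<in> set (nodes t) \<and> u \<in> bag (own (u, v)) \<and> v \<in> bag (own (u, v))"
  using owner by (auto simp: owner_assignment_def)

lemma edges_nodes: "edges (set (nodes t)) = extended_edges G"
  using edge_in_bag by (auto simp: edges_def)

lemma Field_edges:
  assumes "L \<subseteq> edges U" "u \<in> Field L"
  obtains a where "a \<in> U" "a \<in> set (nodes t)" "u \<in> bag a"
  using assms edge_in_bag unfolding Field_def edges_def by blast

text \<open>The new vertex lies in every bag. For an original vertex, the nodes whose bags contain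
  it are connected and meet both \<open>U\<close> and its complement, so they include
  \<open>x\<close>.\<close>

lemma bag_separates:
  assumes "attached t x U" "a \<in> U" "b \<notin> U" "a \<in> set (nodes t)" "b \<in> set (nodes t)"
    "u \<in> bag a" "u \<in> bag b"
  shows "u \<in> bag x"
proof (cases u)
  case (Some v)
  then have "v \<in> B a" "v \<in> B b"
    using assms by auto
  moreover from this have "v \<in> pverts G"
    using bag_subset assms(4) by blast
  ultimately have "x \<in> {y \<in> set (nodes t). v \<in> B y}"
    using assms by (intro attached_separates[OF assms(1) bag_connected, of v a b]) auto
  then show ?thesis
    using Some by simp
qed simp

text \<open>
  \<open>D\<close> can stand in for the live edges owned by \<open>U\<close> at the bag \<open>x\<close>: it records their reachability
  relation on a set \<open>Y\<close> of portals that contains all their endpoints in the bag.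
\<close>

definition branch :: "'a gate list \<Rightarrow> 'b \<Rightarrow> 'b set \<Rightarrow> 'a dist \<Rightarrow> bool" where
  "branch c x U D \<longleftrightarrow> attached t x U \<and> (\<exists>Y\<subseteq>bag x. (\<forall>L\<subseteq>edges U. Field L \<inter> bag x \<subseteq> Y) \<and>
     law p Y c (edges U) (reach_rel Y) D)"

lemma branchI:
  assumes "attached t x U" "Y \<subseteq> bag x" "\<And>L. L \<subseteq> edges U \<Longrightarrow> Field L \<inter> bag x \<subseteq> Y"
    and "law p Y c (edges U) (reach_rel Y) D"
  shows "branch c x U D"
  unfolding branch_def by (intro conjI exI[of _ Y] allI impI assms)

lemma branchE:
  assumes "branch c x U D"
  obtains Y where "Y \<subseteq> bag x" "\<And>L. L \<subseteq> edges U \<Longrightarrow> Field L \<inter> bag x \<subseteq> Y"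
    "law p Y c (edges U) (reach_rel Y) D"
proof -
  obtain Y where "Y \<subseteq> bag x \<and> (\<forall>L\<subseteq>edges U. Field L \<inter> bag x \<subseteq> Y) \<and>
      law p Y c (edges U) (reach_rel Y) D"
    using assms[unfolded branch_def, THEN conjunct2] ..
  then show ?thesis
    by (intro that[of Y]) simp_all
qed

lemma branch_attached: "branch c x U D \<Longrightarrow> attached t x U"
  by (simp add: branch_def)

lemma branch_extends:
  assumes "branch c x U D" "extends c c'"
  shows "branch c' x U D"
proof -
  obtain Y where Y: "Y \<subseteq> bag x" "\<And>L. L \<subseteq> edges U \<Longrightarrow> Field L \<inter> bag x \<subseteq> Y"
    "law p Y c (edges U) (reach_rel Y) D"
    using assms(1) by (rule branchE) blast
  show ?thesis
    by (rule branchI[OF branch_attached[OF assms(1)] Y(1,2) law_extends[OF Y(3) assms(2)]])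
qed

lemma branch_bag:
  assumes "law p (bag x) c (edges U) (reach_rel (bag x)) D" "attached t x U"
  shows "branch c x U D"
  by (rule branchI[OF assms(2) subset_refl Int_lower2 assms(1)])

text \<open>Restriction to the separator loses nothing: an endpoint that lies in the bag of
  \<open>y\<close> also lies in the bag of some node of \<open>U\<close>, and \<open>y\<close> is
  outside \<open>U\<close>, so separation places it in the bag of \<open>x\<close>.\<close>

lemma branch_message:
  assumes "law p (bag x \<inter> bag y) c (edges U) (reach_rel (bag x \<inter> bag y)) D"
    and "attached t x U" "attached t y U" "y \<notin> U" "y \<in> set (nodes t)"
  shows "branch c y U D"
proof -
  have "Field L \<inter> bag y \<subseteq> bag x \<inter> bag y" if L: "L \<subseteq> edges U" for L
  proof
    fix u assume u: "u \<in> Field L \<inter> bag y"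
    obtain a where "a \<in> U" "a \<in> set (nodes t)" "u \<in> bag a"
      using Field_edges[OF L] u by blast
    then show "u \<in> bag x \<inter> bag y"
      using bag_separates[OF assms(2), of a y u] assms(4,5) u by blast
  qed
  then show ?thesis
    by (intro branchI[OF assms(3) Int_lower2 _ assms(1)])
qed

text \<open>A vertex shared by the two edge sets lies in bags on both sides of the boundary of
  \<open>U1\<close>, hence in the bag of \<open>x\<close>, as \<open>reach_rel_combine\<close>
  demands. \<open>Y\<close> is the full bag for partial combinations and the separator for
  messages.\<close>

lemma spec_combine_branches:
  assumes "wf_circuit c" "x \<in> set (nodes t)" "branch c x U1 D1" "branch c x U2 D2"
    and "U1 \<inter> U2 = {}" "Y \<subseteq> bag x"
  shows "spec (combine_gates d) (combine_ops d) (combine (bag x) Y D1 D2)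
    (\<lambda>D c'. law p Y c' (edges (U1 \<union> U2)) (reach_rel Y) D) c"
proof -
  obtain Y1 where Y1: "Y1 \<subseteq> bag x" "\<And>L. L \<subseteq> edges U1 \<Longrightarrow> Field L \<inter> bag x \<subseteq> Y1"
    "law p Y1 c (edges U1) (reach_rel Y1) D1"
    using branchE[OF assms(3)] by metis
  obtain Y2 where Y2: "Y2 \<subseteq> bag x" "\<And>L. L \<subseteq> edges U2 \<Longrightarrow> Field L \<inter> bag x \<subseteq> Y2"
    "law p Y2 c (edges U2) (reach_rel Y2) D2"
    using branchE[OF assms(4)] by metis
  have sep: "Field L1 \<inter> Field L2 \<subseteq> bag x" if L: "L1 \<subseteq> edges U1" "L2 \<subseteq> edges U2" for L1 L2
  proof
    fix u assume u: "u \<in> Field L1 \<inter> Field L2"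
    obtain a where "a \<in> U1" "a \<in> set (nodes t)" "u \<in> bag a"
      using Field_edges[OF L(1)] u by blast
    moreover obtain b where "b \<in> U2" "b \<in> set (nodes t)" "u \<in> bag b"
      using Field_edges[OF L(2)] u by blast
    ultimately show "u \<in> bag x"
      using bag_separates[OF branch_attached[OF assms(3)], of a b u] assms(5) by blast
  qed
  show ?thesis
    unfolding edges_Un
  proof (rule spec_combine_law[OF assms(1) finite_bag[OF assms(2)] card_bag[OF assms(2)]
        law_mono[OF Y1(3,1)] law_mono[OF Y2(3,1)] finite_edges finite_edges
        edges_disjoint[OF assms(5)]])
    fix L1 L2 assume L: "L1 \<subseteq> edges U1" "L2 \<subseteq> edges U2"
    show "reach_rel Y (reach_rel Y1 L1 \<union> reach_rel Y2 L2) = reach_rel Y (L1 \<union> L2)"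
      by (rule reach_rel_combine[OF summarizes_reach_rel[OF Y1(2)[OF L(1)]]
            summarizes_reach_rel[OF Y2(2)[OF L(2)]] sep[OF L] assms(6)])
  qed
qed

lemma spec_combine_at_bag:
  assumes "wf_circuit c" "x \<in> set (nodes t)" "branch c x U1 D1" "branch c x U2 D2"
    and "U1 \<inter> U2 = {}"
  shows "spec (combine_gates d) (combine_ops d) (combine (bag x) (bag x) D1 D2)
    (\<lambda>D c'. branch c' x (U1 \<union> U2) D) c"
proof (rule spec_weaken[OF spec_combine_branches[OF assms subset_refl]])
  have "attached t x (U1 \<union> U2)"
    using assms(3,4) by (intro attached_Un branch_attached)
  then show "branch c' x (U1 \<union> U2) D"
    if "law p (bag x) c' (edges (U1 \<union> U2)) (reach_rel (bag x)) D" for D c'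
    using that by (rule branch_bag[rotated])
qed auto

text \<open>The unit is the branch of the empty node set. It starts the suffix products, and
  combining with it serves to project a relation onto a separator.\<close>

lemma spec_unit_branch:
  assumes "wf_circuit c"
  shows "spec 1 0 (unit_dist (bag x)) (\<lambda>D c'. branch c' x {} D) c"
  by (rule spec_weaken[OF spec_unit_dist[OF assms]]) (auto intro!: branch_bag attached_empty)

text \<open>One gate for the unit; then each of at most \<open>d\<^sup>2\<close> edges within the
  bag takes five gates for its own distribution and one combination.\<close>

definition local_gates :: nat where
  "local_gates = 1 + d\<^sup>2 * (5 + combine_gates d)"

definition local_ops :: nat where
  "local_ops = d\<^sup>2 * combine_ops d"

lemma spec_local_dist:
  assumes "wf_circuit c" and x: "x \<in> set (nodes t)"
  shows "spec local_gates local_ops (local_dist G p B own x) (\<lambda>D c'. branch c' x {x} D) c"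
proof -
  let ?E = "{e \<in> extended_edges G. own e = x}"
  let ?f = "\<lambda>e D. do {De \<leftarrow> edge_dist p e; combine (bag x) (bag x) D De}"
  have E: "?E \<subseteq> bag x \<times> bag x" "finite ?E"
    using edge_in_bag finite_edges[of "{x}"] by (auto simp: edges_def)
  have "card ?E \<le> card (bag x \<times> bag x)"
    using E finite_bag[OF x] by (intro card_mono) auto
  also have "\<dots> \<le> d\<^sup>2"
    using card_bag[OF x] by (simp add: card_cartesian_product power2_eq_square mult_le_mono)
  finally have len: "length (enum ?E) \<le> d\<^sup>2"
    using length_enum[OF E(2)] by simp
  have step: "spec (5 + combine_gates d) (0 + combine_ops d) (?f e D)
      (\<lambda>D c'. law p (bag x) c' (set (ys @ [e])) (reach_rel (bag x)) D) c'"
    if e: "enum ?E = ys @ e # zs" and wf: "wf_circuit c'"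
      and D: "law p (bag x) c' (set ys) (reach_rel (bag x)) D" for e D ys zs c'
  proof -
    have "e \<in> set (enum ?E)"
      unfolding e by simp
    then have eX: "e \<in> bag x \<times> bag x"
      using enum(2)[OF E(2)] E(1) by blast
    have new: "e \<notin> set ys"
      using enum(1)[OF E(2)] e by auto
    show ?thesis
    proof (rule spec_bind[OF spec_edge_dist[OF wf eX]])
      fix De c'' assume c'': "extends c' c''" and De: "law p (bag x) c'' {e} (\<lambda>L. L) De"
      have "spec (combine_gates d) (combine_ops d) (combine (bag x) (bag x) D De)
        (\<lambda>D c'. law p (bag x) c' (set ys \<union> {e}) (reach_rel (bag x)) D) c''"
      proof (rule spec_combine_law[OF extends_wf[OF c''] finite_bag[OF x] card_bag[OF x]
            law_extends[OF D c''] De])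
        \<comment> \<open>The distribution of a single edge stores the raw edge set rather than its
          closure, so it summarizes itself; separation is immediate because both endpoints are in
          the bag.\<close>
        fix L1 L2 assume "L2 \<subseteq> {e}"
        then have "Field L2 \<subseteq> bag x"
          using eX by (auto simp: Field_def)
        then show "reach_rel (bag x) (reach_rel (bag x) L1 \<union> L2) = reach_rel (bag x) (L1 \<union> L2)"
          by (intro reach_rel_combine summarizes_reach_rel summarizes_refl) auto
      qed (use new in auto)
      then show "spec (combine_gates d) (combine_ops d) (combine (bag x) (bag x) D De)
        (\<lambda>D c'. law p (bag x) c' (set (ys @ [e])) (reach_rel (bag x)) D) c''"
        by simp
    qed
  qed
  have "spec (1 + (\<Sum>e\<leftarrow>enum ?E. 5 + combine_gates d)) (0 + (\<Sum>e\<leftarrow>enum ?E. 0 + combine_ops d))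
    (local_dist G p B own x) (\<lambda>D c'. law p (bag x) c' (set (enum ?E)) (reach_rel (bag x)) D) c"
    unfolding local_dist_def
  proof (rule spec_bind[OF spec_unit_dist[OF assms(1)]])
    fix D c' assume c': "extends c c'" and D: "law p (bag x) c' {} (reach_rel (bag x)) D"
    show "spec (\<Sum>e\<leftarrow>enum ?E. 5 + combine_gates d) (\<Sum>e\<leftarrow>enum ?E. 0 + combine_ops d)
      (foldM ?f (enum ?E) D) (\<lambda>D c'. law p (bag x) c' (set (enum ?E)) (reach_rel (bag x)) D) c'"
    proof (rule spec_foldM[where I = "\<lambda>ys D c'. law p (bag x) c' (set ys) (reach_rel (bag x)) D"])
      show "law p (bag x) c' (set []) (reach_rel (bag x)) D"
        using D by simp
      fix ys y zs D c'' assume y: "enum ?E = ys @ y # zs" and c'': "extends c' c''"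
        and D: "law p (bag x) c'' (set ys) (reach_rel (bag x)) D"
      show "spec (5 + combine_gates d) (0 + combine_ops d) (?f y D)
        (\<lambda>D c'. law p (bag x) c' (set (ys @ [y])) (reach_rel (bag x)) D) c''"
        by (rule step[OF y extends_wf[OF c''] D])
    qed (rule extends_wf[OF c'])
  qed
  then show ?thesis
  proof (rule spec_weaken)
    have "set (enum ?E) = edges {x}"
      using enum(2)[OF E(2)] by (simp add: edges_def)
    then show "branch c' x {x} D"
      if "law p (bag x) c' (set (enum ?E)) (reach_rel (bag x)) D" for D c'
      using that by (intro branch_bag attached_singleton) simp
  qed (use len in \<open>simp_all add: local_gates_def local_ops_def sum_list_triv\<close>)
qed

text \<open>\<open>W z\<close> is the set of nodes behind the neighbor \<open>z\<close>: a subtree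
  if \<open>z\<close> is a child, the complement of the subtree at \<open>x\<close> if
  \<open>z\<close> is the parent.\<close>

lemma spec_absorb:
  assumes "wf_circuit c" and x: "x \<in> set (nodes t)" and "branch c x U0 D"
    and msg: "\<And>z. z \<in> set zs \<Longrightarrow> branch c x (W z) (M (z, x))"
    and "distinct zs" "\<And>z. z \<in> set zs \<Longrightarrow> U0 \<inter> W z = {}"
    and "\<And>z z'. z \<in> set zs \<Longrightarrow> z' \<in> set zs \<Longrightarrow> z \<noteq> z' \<Longrightarrow> W z \<inter> W z' = {}"
  shows "spec (length zs * combine_gates d) (length zs * combine_ops d) (absorb B x M zs D)
    (\<lambda>D c'. branch c' x (U0 \<union> (\<Union>z\<in>set zs. W z)) D) c"
proof -
  have "spec (\<Sum>z\<leftarrow>zs. combine_gates d) (\<Sum>z\<leftarrow>zs. combine_ops d) (absorb B x M zs D)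
    (\<lambda>D c'. branch c' x (U0 \<union> (\<Union>z\<in>set zs. W z)) D) c"
    unfolding absorb_def
  proof (rule spec_foldM[where I = "\<lambda>ys D c'. branch c' x (U0 \<union> (\<Union>z\<in>set ys. W z)) D"])
    fix ys y zs' D c'
    assume zs: "zs = ys @ y # zs'" and c': "extends c c'"
      and D: "branch c' x (U0 \<union> (\<Union>z\<in>set ys. W z)) D"
    have "branch c' x (W y) (M (y, x))"
      using msg[of y] zs c' branch_extends by simp
    moreover have "(U0 \<union> (\<Union>z\<in>set ys. W z)) \<inter> W y = {}"
    proof -
      have "W z \<inter> W y = {}" if "z \<in> set ys" for z
        using that assms(5) unfolding zs by (intro assms(7)) (auto simp: zs)
      moreover have "U0 \<inter> W y = {}"
        using assms(6) zs by auto
      ultimately show ?thesis by blast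
    qed
    ultimately have "spec (combine_gates d) (combine_ops d) (combine (bag x) (bag x) D (M (y, x)))
      (\<lambda>D c'. branch c' x ((U0 \<union> (\<Union>z\<in>set ys. W z)) \<union> W y) D) c'"
      by (intro spec_combine_at_bag[OF extends_wf[OF c'] x D])
    then show "spec (combine_gates d) (combine_ops d) (combine (bag x) (bag x) D (M (y, x)))
      (\<lambda>D c'. branch c' x (U0 \<union> (\<Union>z\<in>set (ys @ [y]). W z)) D) c'"
      by (simp add: Un_ac)
  qed (use assms in auto)
  then show ?thesis
    by (simp add: sum_list_triv)
qed

section \<open>The upward sweep\<close>

lemma spec_upward:
  assumes "wf_circuit c" and L: "\<And>x. x \<in> set (nodes t) \<Longrightarrow> branch c x {x} (L x)"
  shows "spec (\<Sum>(y, x)\<leftarrow>rev (tree_arcs t). length (children t x) * combine_gates d + (1 + combine_gates d))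
    (\<Sum>(y, x)\<leftarrow>rev (tree_arcs t). length (children t x) * combine_ops d + (0 + combine_ops d))
    (upward t B L M0) (\<lambda>M c'. \<forall>(y, x)\<in>set (tree_arcs t). branch c' y (subtree t x) (M (x, y))) c"
proof -
  define I where "I as M c' \<longleftrightarrow> (\<forall>(y, x)\<in>set as. branch c' y (subtree t x) (M (x, y)))"
    for as M c'
  let ?f = "\<lambda>(y, x) M. do {
        P \<leftarrow> absorb B x M (children t x) (L x);
        U \<leftarrow> unit_dist (bag x);
        D \<leftarrow> combine (bag x) (bag x \<inter> bag y) P U;
        State_Monad.return (M((x, y) := D))
      }"
  have "spec (\<Sum>(y, x)\<leftarrow>rev (tree_arcs t). length (children t x) * combine_gates d + (1 + combine_gates d))
    (\<Sum>(y, x)\<leftarrow>rev (tree_arcs t). length (children t x) * combine_ops d + (0 + combine_ops d))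
    (upward t B L M0) (I (rev (tree_arcs t))) c"
    unfolding upward_def
  proof (rule spec_foldM)
    fix ys a zs M c'
    assume arcs: "rev (tree_arcs t) = ys @ a # zs" and c': "extends c c'" and I: "I ys M c'"
    obtain y x where a: "a = (y, x)" by (cases a)
    have arcs': "tree_arcs t = rev zs @ (y, x) # rev ys"
      using arcs a by (simp add: rev_swap)
    then have yx: "(y, x) \<in> set (tree_arcs t)" by simp
    then have x: "x \<in> set (nodes t)" and y: "y \<in> set (nodes t)"
      using tree_arcs_in_nodes[OF distinct_nodes] by auto
    \<comment> \<open>In reversed preorder the arcs from \<open>x\<close> to its children come
      before the arc into \<open>x\<close>.\<close>
    have msgs: "branch c' x (subtree t z) (M (z, x))" if "z \<in> set (children t x)" for z
    proof -
      have "(x, z) \<in> set ys"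
        using arc_before[OF distinct_nodes arcs'] that by (simp add: set_children)
      then show ?thesis using I unfolding I_def by blast
    qed
    have dis: "{x} \<inter> subtree t z = {}" if "z \<in> set (children t x)" for z
      using parent_notin_subtree[OF distinct_nodes] that by (simp add: set_children)
    have dis': "subtree t z \<inter> subtree t z' = {}"
      if "z \<in> set (children t x)" "z' \<in> set (children t x)" "z \<noteq> z'" for z z'
      using subtree_disjoint[OF distinct_nodes] that by (simp add: set_children)
    have sub: "{x} \<union> (\<Union>z\<in>set (children t x). subtree t z) = subtree t x"
      using subtree_unfold[of t x] by simp
    have "spec (length (children t x) * combine_gates d + (1 + (combine_gates d + 0)))
      (length (children t x) * combine_ops d + (0 + (combine_ops d + 0))) (?f (y, x) M)
      (I (ys @ [(y, x)])) c'"
      unfolding prod.case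
    proof (rule spec_bind[OF spec_absorb[where W = "subtree t" and zs = "children t x" and M = M,
            OF extends_wf[OF c'] x branch_extends[OF L[OF x] c'] msgs
            distinct_children[OF distinct_nodes] dis dis'], unfolded sub])
      fix P c1 assume c1: "extends c' c1" and P: "branch c1 x (subtree t x) P"
      show "spec (1 + (combine_gates d + 0)) (0 + (combine_ops d + 0))
        (do {
          U \<leftarrow> unit_dist (bag x);
          D \<leftarrow> combine (bag x) (bag x \<inter> bag y) P U;
          State_Monad.return (M((x, y) := D))
        }) (I (ys @ [(y, x)])) c1"
      proof (rule spec_bind[OF spec_unit_branch[where x = x, OF extends_wf[OF c1]]])
        fix U c2 assume c2: "extends c1 c2" and U: "branch c2 x {} U"
        show "spec (combine_gates d + 0) (combine_ops d + 0)
          (do {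
            D \<leftarrow> combine (bag x) (bag x \<inter> bag y) P U;
            State_Monad.return (M((x, y) := D))
          }) (I (ys @ [(y, x)])) c2"
        proof (rule spec_bind[OF spec_combine_branches[OF extends_wf[OF c2] x
                branch_extends[OF P c2] U Int_empty_right Int_lower1, unfolded Un_empty_right]])
          fix D c3 assume c3: "extends c2 c3"
            and "law p (bag x \<inter> bag y) c3 (edges (subtree t x)) (reach_rel (bag x \<inter> bag y)) D"
          then have "branch c3 y (subtree t x) D"
            using attached_subtree[OF distinct_nodes yx] parent_notin_subtree[OF distinct_nodes yx] y
            by (intro branch_message[where x = x]) auto
          moreover have "extends c' c3"
            using c1 c2 c3 extends_trans by blast
          ultimately have "I (ys @ [(y, x)]) (M((x, y) := D)) c3"
            using I branch_extends unfolding I_def by (auto simp: case_prod_beta)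
          then show "spec 0 0 (State_Monad.return (M((x, y) := D))) (I (ys @ [(y, x)])) c3"
            using c3 by (intro spec_return) (auto intro: extends_wf)
        qed
      qed
    qed
    then show "spec (case a of (y, x) \<Rightarrow> length (children t x) * combine_gates d + (1 + combine_gates d))
      (case a of (y, x) \<Rightarrow> length (children t x) * combine_ops d + (0 + combine_ops d)) (?f a M)
      (I (ys @ [a])) c'"
      using a by simp
  qed (use assms(1) in \<open>auto simp: I_def\<close>)
  then show ?thesis
    by (rule spec_weaken) (auto simp: I_def)
qed

text \<open>\<open>P\<close> is a prefix product covering \<open>U0\<close>, \<open>U\<close> a
  suffix product covering the remaining children; the message to \<open>y\<close> combines the two
  around \<open>W y\<close>. Each child causes three combinations: prefix, message and suffix. Other
  entries of \<open>M\<close> are kept since the upward messages are still read, and the attachment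
  at \<open>x\<close> is what \<open>branch_message\<close> needs to turn a message into a branch at
  the child.\<close>

lemma spec_send_down:
  assumes "wf_circuit c" and x: "x \<in> set (nodes t)" and "branch c x U0 P"
    and "\<And>y. y \<in> set ys \<Longrightarrow> branch c x (W y) (M (y, x))"
    and "distinct ys" "\<And>y. y \<in> set ys \<Longrightarrow> U0 \<inter> W y = {}"
    and "\<And>y z. y \<in> set ys \<Longrightarrow> z \<in> set ys \<Longrightarrow> y \<noteq> z \<Longrightarrow> W y \<inter> W z = {}"
  shows "spec (1 + length ys * (3 * combine_gates d)) (length ys * (3 * combine_ops d))
    (send_down B x ys P M)
    (\<lambda>(M', Q, U) c'. (\<forall>e. e \<notin> Pair x ` set ys \<longrightarrow> M' e = M e) \<and>
       (\<forall>y\<in>set ys. attached t x (U0 \<union> (\<Union>z\<in>set ys - {y}. W z)) \<and>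
         law p (bag x \<inter> bag y) c' (edges (U0 \<union> (\<Union>z\<in>set ys - {y}. W z)))
           (reach_rel (bag x \<inter> bag y)) (M' (x, y))) \<and>
       branch c' x (U0 \<union> (\<Union>z\<in>set ys. W z)) Q \<and> branch c' x (\<Union>z\<in>set ys. W z) U) c"
  using assms(1,3-7)
proof (induction ys arbitrary: c U0 P)
  case Nil
  have "spec (1 + 0) (0 + 0) (send_down B x [] P M)
    (\<lambda>(M', Q, U) c'. M' = M \<and> branch c' x U0 Q \<and> branch c' x {} U) c"
    unfolding send_down.simps
  proof (rule spec_bind[OF spec_unit_branch[where x = x, OF Nil(1)]])
    fix U c' assume "extends c c'" "branch c' x {} U"
    then show "spec 0 0 (State_Monad.return (M, P, U))
      (\<lambda>(M', Q, U) c'. M' = M \<and> branch c' x U0 Q \<and> branch c' x {} U) c'"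
      using branch_extends[OF Nil(2)] by (intro spec_return) (auto intro: extends_wf)
  qed
  then show ?case
    by (rule spec_weaken) auto
next
  case (Cons y ys)
  let ?R = "\<Union>z\<in>set ys. W z"
  let ?Y = "bag x \<inter> bag y"
  have y: "branch c x (W y) (M (y, x))" "U0 \<inter> W y = {}" "y \<notin> set ys"
    using Cons.prems by auto
  have dis: "W y \<inter> ?R = {}" "U0 \<inter> ?R = {}"
  proof -
    have "W y \<inter> W z = {}" if "z \<in> set ys" for z
      by (rule Cons.prems(6)) (use that y(3) in auto)
    then show "W y \<inter> ?R = {}" by blast
    have "U0 \<inter> W z = {}" if "z \<in> set ys" for z
      by (rule Cons.prems(5)) (use that in simp)
    then show "U0 \<inter> ?R = {}" by blast
  qed
  define POST where "POST = (\<lambda>(M', Q, U) c'.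
       (\<forall>e. e \<notin> Pair x ` set (y # ys) \<longrightarrow> M' e = M e) \<and>
       (\<forall>y'\<in>set (y # ys). attached t x (U0 \<union> (\<Union>z\<in>set (y # ys) - {y'}. W z)) \<and>
         law p (bag x \<inter> bag y') c' (edges (U0 \<union> (\<Union>z\<in>set (y # ys) - {y'}. W z)))
           (reach_rel (bag x \<inter> bag y')) (M' (x, y'))) \<and>
       branch c' x (U0 \<union> (\<Union>z\<in>set (y # ys). W z)) Q \<and> branch c' x (\<Union>z\<in>set (y # ys). W z) U)"
  have "spec (combine_gates d + ((1 + length ys * (3 * combine_gates d)) + (combine_gates d + (combine_gates d + 0))))
    (combine_ops d + (length ys * (3 * combine_ops d) + (combine_ops d + (combine_ops d + 0))))
    (send_down B x (y # ys) P M) POST c"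
    unfolding send_down.simps
  proof (rule spec_bind[OF spec_combine_at_bag[OF Cons.prems(1) x Cons.prems(2) y(1,2)]])
    fix P' c1 assume c1: "extends c c1" and P': "branch c1 x (U0 \<union> W y) P'"
    have msgs: "branch c1 x (W z) (M (z, x))" if "z \<in> set ys" for z
      by (rule branch_extends[OF Cons.prems(3) c1]) (use that in simp)
    have dis1: "(U0 \<union> W y) \<inter> W z = {}" if "z \<in> set ys" for z
      using dis that by blast
    have dis2: "W z \<inter> W z' = {}" if "z \<in> set ys" "z' \<in> set ys" "z \<noteq> z'" for z z'
      using Cons.prems(6) that by simp
    have "distinct ys" using Cons.prems(4) by simp
    note IH = Cons.IH[OF extends_wf[OF c1] P' msgs this dis1 dis2]
    show "spec ((1 + length ys * (3 * combine_gates d)) + (combine_gates d + (combine_gates d + 0)))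
      (length ys * (3 * combine_ops d) + (combine_ops d + (combine_ops d + 0)))
      (do {
        (M', Q, U) \<leftarrow> send_down B x ys P' M;
        D \<leftarrow> combine (bag x) ?Y P U;
        U' \<leftarrow> combine (bag x) (bag x) (M (y, x)) U;
        State_Monad.return (M'((x, y) := D), Q, U')
      }) POST c1"
    proof (rule spec_bind[OF IH], assumption+, goal_cases)
      case (1 r c2)
      obtain M' Q U where r: "r = (M', Q, U)" by (metis prod_cases3)
      have c2: "extends c1 c2" and old: "\<And>e. e \<notin> Pair x ` set ys \<Longrightarrow> M' e = M e"
        and new: "\<And>y'. y' \<in> set ys \<Longrightarrow> attached t x (U0 \<union> W y \<union> (\<Union>z\<in>set ys - {y'}. W z)) \<and>
         law p (bag x \<inter> bag y') c2 (edges (U0 \<union> W y \<union> (\<Union>z\<in>set ys - {y'}. W z)))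
           (reach_rel (bag x \<inter> bag y')) (M' (x, y'))"
        and Q: "branch c2 x (U0 \<union> W y \<union> ?R) Q" and U: "branch c2 x ?R U"
        using 1(1) 1(2)[unfolded r prod.case, THEN conjunct1, rule_format]
          1(2)[unfolded r prod.case, THEN conjunct2, THEN conjunct1, rule_format]
          1(2)[unfolded r prod.case, THEN conjunct2, THEN conjunct2] by simp_all
      have c02: "extends c c2" using c1 c2 by (rule extends_trans)
      show ?case
        unfolding r prod.case
      proof (rule spec_bind[OF spec_combine_branches[OF extends_wf[OF c2] x
              branch_extends[OF Cons.prems(2) c02] U dis(2) Int_lower1]])
        fix D c3 assume c3: "extends c2 c3"
          and D: "law p ?Y c3 (edges (U0 \<union> ?R)) (reach_rel ?Y) D"
        have c03: "extends c c3" using c02 c3 by (rule extends_trans)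
        show "spec (combine_gates d + 0) (combine_ops d + 0)
          (do {
            U' \<leftarrow> combine (bag x) (bag x) (M (y, x)) U;
            State_Monad.return (M'((x, y) := D), Q, U')
          }) POST c3"
        proof (rule spec_bind[OF spec_combine_at_bag[OF extends_wf[OF c3] x
                branch_extends[OF y(1) c03] branch_extends[OF U c3] dis(1)]])
          fix U' c4 assume c4: "extends c3 c4" and U': "branch c4 x (W y \<union> ?R) U'"
          have c24: "extends c2 c4" using c3 c4 by (rule extends_trans)
          have "attached t x (U0 \<union> ?R)"
            using Cons.prems(2) U by (intro attached_Un branch_attached)
          have law: "attached t x (U0 \<union> (\<Union>z\<in>set (y # ys) - {y'}. W z)) \<and>
            law p (bag x \<inter> bag y') c4 (edges (U0 \<union> (\<Union>z\<in>set (y # ys) - {y'}. W z)))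
              (reach_rel (bag x \<inter> bag y')) ((M'((x, y) := D)) (x, y'))" if y': "y' \<in> set (y # ys)" for y'
          proof (cases "y' = y")
            case True
            then have "set (y # ys) - {y'} = set ys"
              using y(3) by auto
            then show ?thesis
              using True law_extends[OF D c4] \<open>attached t x (U0 \<union> ?R)\<close> by simp
          next
            case False
            \<comment> \<open>The recursive call started from the prefix
              \<open>U0 \<union> W y\<close>, so its messages to later children already account for
              \<open>y\<close>.\<close>
            then have "U0 \<union> (\<Union>z\<in>set (y # ys) - {y'}. W z) = U0 \<union> W y \<union> (\<Union>z\<in>set ys - {y'}. W z)"
              by auto
            then show ?thesis
              using False y' new[of y'] law_extends[OF _ c24] by simp
          qed
          have "U0 \<union> (\<Union>z\<in>set (y # ys). W z) = U0 \<union> W y \<union> ?R" "(\<Union>z\<in>set (y # ys). W z) = W y \<union> ?R"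
            by auto
          moreover have "(M'((x, y) := D)) e = M e" if "e \<notin> Pair x ` set (y # ys)" for e
            using that old[of e] by auto
          ultimately have "POST (M'((x, y) := D), Q, U') c4"
            unfolding POST_def prod.case using law U' branch_extends[OF Q c24]
            by (intro conjI allI ballI impI) simp_all
          then show "spec 0 0 (State_Monad.return (M'((x, y) := D), Q, U')) POST c4"
            using c4 by (intro spec_return) (auto intro: extends_wf)
        qed
      qed
    qed
  qed
  then show ?case
    unfolding POST_def by (rule spec_weaken) (simp_all add: algebra_simps)
qed

section \<open>The downward sweep over all nodes\<close>

definition down_gates :: "'b \<Rightarrow> nat" where
  "down_gates x = combine_gates d + (1 + length (children t x) * (3 * combine_gates d))"

definition down_ops :: "'b \<Rightarrow> nat" where
  "down_ops x = combine_ops d + length (children t x) * (3 * combine_ops d)"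

lemma spec_downward:
  assumes "wf_circuit c" and L: "\<And>x. x \<in> set (nodes t) \<Longrightarrow> branch c x {x} (L x)"
    and up: "\<And>x y. (y, x) \<in> set (tree_arcs t) \<Longrightarrow> branch c y (subtree t x) (M (x, y))"
  shows "spec (\<Sum>x\<leftarrow>nodes t. down_gates x) (\<Sum>x\<leftarrow>nodes t. down_ops x) (downward t B L M)
    (\<lambda>(M', Q) c'. \<forall>x\<in>set (nodes t). branch c' x (set (nodes t)) (Q x)) c"
proof -
  let ?V = "set (nodes t)"
  \<comment> \<open>Upward messages stay intact throughout; a downward message across an arc
    \<open>(a, b)\<close> exists once \<open>a\<close> is visited and covers everything outside the
    subtree at \<open>b\<close>.\<close>
  define I where "I ys = (\<lambda>(M, Q) c'.
      (\<forall>(a, b)\<in>set (tree_arcs t). branch c' a (subtree t b) (M (b, a))) \<and>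
      (\<forall>(a, b)\<in>set (tree_arcs t). a \<in> set ys \<longrightarrow> branch c' b (?V - subtree t b) (M (a, b))) \<and>
      (\<forall>x\<in>set ys. branch c' x ?V (Q x)))"
    for ys and c' :: "'a gate list"
  let ?f = "\<lambda>x (M, Q). do {
        P \<leftarrow> absorb B x M (parents t x) (L x);
        (M', Qx, U) \<leftarrow> send_down B x (children t x) P M;
        State_Monad.return (M', Q(x := Qx))
      }"
  have "spec (\<Sum>x\<leftarrow>nodes t. down_gates x) (\<Sum>x\<leftarrow>nodes t. down_ops x) (downward t B L M)
    (I (nodes t)) c"
    unfolding downward_def
  proof (rule spec_foldM)
    fix ys x zs r c'
    assume nodes: "nodes t = ys @ x # zs" and c': "extends c c'" and "I ys r c'"
    moreover obtain M Q where r: "r = (M, Q)" by (cases r)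
    ultimately have M_up: "\<And>a b. (a, b) \<in> set (tree_arcs t) \<Longrightarrow> branch c' a (subtree t b) (M (b, a))"
      and M_down: "\<And>a b. (a, b) \<in> set (tree_arcs t) \<Longrightarrow> a \<in> set ys \<Longrightarrow>
        branch c' b (?V - subtree t b) (M (a, b))"
      and Q: "\<And>x. x \<in> set ys \<Longrightarrow> branch c' x ?V (Q x)"
      unfolding I_def by auto
    have x: "x \<in> ?V" and x_new: "x \<notin> set ys"
      using nodes distinct_nodes by auto
    have child: "(x, z) \<in> set (tree_arcs t)" if "z \<in> set (children t x)" for z
      using that by (simp add: set_children)
    have sub: "subtree t x = insert x (\<Union>z\<in>set (children t x). subtree t z)"
      by (rule subtree_unfold)
    have subV: "subtree t x \<subseteq> ?V"
      by (rule subtree_subset[OF distinct_nodes x])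
    have dis: "subtree t z \<inter> subtree t z' = {}"
      if "z \<in> set (children t x)" "z' \<in> set (children t x)" "z \<noteq> z'" for z z'
      using subtree_disjoint[OF distinct_nodes] that by (simp add: set_children)
    \<comment> \<open>All nodes except the proper descendants of \<open>x\<close>: the part of the
      tree known before any child is absorbed. At the root it is just \<open>{x}\<close>.\<close>
    define U0 where "U0 = insert x (?V - subtree t x)"
    have dis0: "U0 \<inter> subtree t z = {}" if "z \<in> set (children t x)" for z
      using parent_notin_subtree[OF distinct_nodes child[OF that]] that sub unfolding U0_def by blast
    have par: "spec (combine_gates d) (combine_ops d) (absorb B x M (parents t x) (L x))
      (\<lambda>P c'. branch c' x U0 P) c'"
    proof (rule parents_cases[OF distinct_nodes x])
      assume "x = root_of t" "parents t x = []"
      moreover from this have "U0 = {x}"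
        by (simp add: U0_def subtree_root[OF distinct_nodes])
      ultimately have "spec 0 0 (absorb B x M (parents t x) (L x)) (\<lambda>P c'. branch c' x U0 P) c'"
        using branch_extends[OF L[OF x] c'] extends_wf[OF c']
        by (simp add: absorb_def spec_return)
      then show ?thesis
        by (rule spec_weaken) auto
    next
      fix y assume y: "parents t x = [y]" "(y, x) \<in> set (tree_arcs t)"
      have "y \<in> set ys"
        using node_before[OF distinct_nodes nodes y(2)] .
      then have "branch c' x (?V - subtree t x) (M (y, x))"
        using M_down y(2) by blast
      then have "spec (length [y] * combine_gates d) (length [y] * combine_ops d) (absorb B x M [y] (L x))
        (\<lambda>D c'. branch c' x ({x} \<union> (\<Union>z\<in>set [y]. ?V - subtree t x)) D) c'"
        by (intro spec_absorb[OF extends_wf[OF c'] x branch_extends[OF L[OF x] c']]) auto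
      then show ?thesis
        using y(1) by (simp add: U0_def)
    qed
    have "spec (combine_gates d + ((1 + length (children t x) * (3 * combine_gates d)) + 0))
      (combine_ops d + (length (children t x) * (3 * combine_ops d) + 0)) (?f x (M, Q)) (I (ys @ [x])) c'"
      unfolding prod.case
    proof (rule spec_bind[OF par])
      fix P c1 assume c1: "extends c' c1" and P: "branch c1 x U0 P"
      have msgs: "branch c1 x (subtree t z) (M (z, x))" if "z \<in> set (children t x)" for z
        using branch_extends[OF M_up[OF child[OF that]] c1] .
      show "spec ((1 + length (children t x) * (3 * combine_gates d)) + 0)
        (length (children t x) * (3 * combine_ops d) + 0)
        (do {
          (M', Qx, U) \<leftarrow> send_down B x (children t x) P M;
          State_Monad.return (M', Q(x := Qx))
        }) (I (ys @ [x])) c1"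
      proof (rule spec_bind[OF spec_send_down[where W = "subtree t" and ys = "children t x" and M = M,
              OF extends_wf[OF c1] x P msgs distinct_children[OF distinct_nodes] dis0 dis]],
            assumption+, goal_cases)
        case (1 r2 c2)
        obtain M' Qx U where r2: "r2 = (M', Qx, U)" by (metis prod_cases3)
        have c2: "extends c1 c2" and old: "\<And>e. e \<notin> Pair x ` set (children t x) \<Longrightarrow> M' e = M e"
          and new: "\<And>y. y \<in> set (children t x) \<Longrightarrow>
            attached t x (U0 \<union> (\<Union>z\<in>set (children t x) - {y}. subtree t z)) \<and>
            law p (bag x \<inter> bag y) c2 (edges (U0 \<union> (\<Union>z\<in>set (children t x) - {y}. subtree t z)))
             (reach_rel (bag x \<inter> bag y)) (M' (x, y))"
          and Qx: "branch c2 x (U0 \<union> (\<Union>z\<in>set (children t x). subtree t z)) Qx"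
          using 1(1) 1(2)[unfolded r2 prod.case, THEN conjunct1, rule_format]
            1(2)[unfolded r2 prod.case, THEN conjunct2, THEN conjunct1, rule_format]
            1(2)[unfolded r2 prod.case, THEN conjunct2, THEN conjunct2] by simp_all
        have c02: "extends c' c2" using c1 c2 by (rule extends_trans)
        have all: "U0 \<union> (\<Union>z\<in>set (children t x). subtree t z) = ?V"
          using subV x unfolding U0_def sub by blast
        have down: "branch c2 b (?V - subtree t b) (M' (x, b))" if b: "(x, b) \<in> set (tree_arcs t)" for b
        proof -
          have bc: "b \<in> set (children t x)" using b by (simp add: set_children)
          have U: "U0 \<union> (\<Union>z\<in>set (children t x) - {b}. subtree t z) = ?V - subtree t b"
            using all dis0[OF bc] dis[OF _ bc] bc by blast
          have "b \<in> ?V" using tree_arcs_in_nodes[OF distinct_nodes b] by simp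
          then show ?thesis
            using new[OF bc] attached_complement[OF distinct_nodes attached_subtree(2)[OF distinct_nodes b]]
            unfolding U by (intro branch_message[where x = x]) auto
        qed
        \<comment> \<open>Overwritten entries run from \<open>x\<close> to a child. If one of them
          were also an upward message, two arcs would form a cycle.\<close>
        have not_up: "(b, a) \<notin> Pair x ` set (children t x)" if "(a, b) \<in> set (tree_arcs t)" for a b
        proof
          assume "(b, a) \<in> Pair x ` set (children t x)"
          then have "b = x" "(x, a) \<in> set (tree_arcs t)"
            by (auto simp: set_children)
          then show False
            using parent_notin_subtree[OF distinct_nodes that] by (auto simp: subtree_def)
        qed
        have "I (ys @ [x]) (M', Q(x := Qx)) c2"
          unfolding I_def prod.case
        proof (intro conjI ballI)
          fix e assume e: "e \<in> set (tree_arcs t)"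
          obtain a b where ab: "e = (a, b)" by (cases e)
          show "case e of (a, b) \<Rightarrow> branch c2 a (subtree t b) (M' (b, a))"
            using branch_extends[OF M_up c02] e old[OF not_up] unfolding ab by simp
          show "case e of (a, b) \<Rightarrow> a \<in> set (ys @ [x]) \<longrightarrow> branch c2 b (?V - subtree t b) (M' (a, b))"
          proof (cases "a = x")
            case True
            then show ?thesis using down e ab by simp
          next
            case False
            then have "(a, b) \<notin> Pair x ` set (children t x)" by auto
            then show ?thesis
              using branch_extends[OF M_down c02] e old False unfolding ab by simp
          qed
        next
          fix z assume "z \<in> set (ys @ [x])"
          then show "branch c2 z ?V ((Q(x := Qx)) z)"
            using Qx x_new branch_extends[OF Q c02] unfolding all by auto
        qed
        then show ?case
          using c2 unfolding r2 prod.case by (intro spec_return) (auto intro: extends_wf)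
      qed
    qed
    then show "spec (down_gates x) (down_ops x) (?f x r) (I (ys @ [x])) c'"
      unfolding r by (simp add: down_gates_def down_ops_def)
  qed (use assms in \<open>auto simp: I_def\<close>)
  then show ?thesis
    by (rule spec_weaken) (auto simp: I_def)
qed

text \<open>The nesting follows the binds of \<open>compile\<close>. Reading off one vertex takes a
  zero constant, at most \<open>2 ^ d\<^sup>2\<close> additions, and one addition to the
  total.\<close>

definition compile_gates :: nat where
  "compile_gates = (\<Sum>x\<leftarrow>nodes t. local_gates) +
     ((\<Sum>(y, x)\<leftarrow>rev (tree_arcs t). length (children t x) * combine_gates d + (1 + combine_gates d)) +
     ((\<Sum>x\<leftarrow>nodes t. down_gates x) + (1 + card (pverts G) * (2 + 2 ^ d\<^sup>2))))"

definition compile_ops :: nat where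
  "compile_ops = (\<Sum>x\<leftarrow>nodes t. local_ops) +
     ((\<Sum>(y, x)\<leftarrow>rev (tree_arcs t). length (children t x) * combine_ops d + (0 + combine_ops d)) +
     ((\<Sum>x\<leftarrow>nodes t. down_ops x) + 0))"

section \<open>Reading off the probabilities and assembling the circuit\<close>

lemma reach_probability:
  assumes "branch c x (set (nodes t)) D" "v \<in> B x"
  shows "(\<Sum>i\<leftarrow>map snd (filter (\<lambda>(R, i). (None, Some v) \<in> R) D). gate_value c \<theta> i) =
    expect (edge_weight p \<theta>) (extended_edges G) (\<lambda>L. of_bool ((None, Some v) \<in> L\<^sup>*))"
proof -
  obtain Y where Y: "Y \<subseteq> bag x" "\<And>L. L \<subseteq> edges (set (nodes t)) \<Longrightarrow> Field L \<inter> bag x \<subseteq> Y"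
    "law p Y c (edges (set (nodes t))) (reach_rel Y) D"
    using branchE[OF assms(1)] by metis
  have "(\<Sum>i\<leftarrow>map snd (filter (\<lambda>(R, i). (None, Some v) \<in> R) D). gate_value c \<theta> i) =
      mass c \<theta> (\<lambda>R. of_bool ((None, Some v) \<in> R)) D"
    unfolding mass_def by (induction D) auto
  also have "\<dots> = expect (edge_weight p \<theta>) (extended_edges G)
      (\<lambda>L. of_bool ((None, Some v) \<in> reach_rel Y L))"
    using Y(3) by (simp add: law_def edges_nodes)
  also have "\<dots> = expect (edge_weight p \<theta>) (extended_edges G)
      (\<lambda>L. of_bool ((None, Some v) \<in> L\<^sup>*))"
  proof (rule expect_cong)
    fix L assume "L \<subseteq> extended_edges G"
    then have "Field L \<inter> bag x \<subseteq> Y"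
      using Y(2) by (simp add: edges_nodes)
    \<comment> \<open>The portals \<open>Y\<close> may be a proper subset of the bag. As
      \<open>None\<close> and \<open>Some v\<close> differ, a path between them is nontrivial, so
      its endpoints are incident with live edges and belong to \<open>Y\<close>.\<close>
    moreover have "None \<in> Field L \<and> Some v \<in> Field L" if "(None, Some v) \<in> L\<^sup>*"
      using rtrancl_Field[OF that] by simp
    ultimately show "of_bool ((None, Some v) \<in> reach_rel Y L) = (of_bool ((None, Some v) \<in> L\<^sup>*) :: real)"
      using assms(2) by (auto simp: reach_rel_def)
  qed simp
  finally show ?thesis .
qed

lemma spec_readout:
  assumes "wf_circuit c" "F < length c" "\<And>\<theta>. gate_value c \<theta> F = 0"
    and Q: "\<And>x. x \<in> set (nodes t) \<Longrightarrow> branch c x (set (nodes t)) (Q x)"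
  shows "spec (card (pverts G) * (2 + 2 ^ d\<^sup>2)) 0
    (foldM (\<lambda>v F. do {
        P \<leftarrow> sum_gates (map snd (filter (\<lambda>(R, i). (None, Some v) \<in> R) (Q (rd v))));
        emit (Add F P)
      }) (enum (pverts G)) F)
    (\<lambda>out c'. out < length c' \<and> (\<forall>\<theta>. gate_value c' \<theta> out = extended_influence G p \<theta>)) c"
proof -
  let ?pr = "\<lambda>\<theta> v. expect (edge_weight p \<theta>) (extended_edges G) (\<lambda>L. of_bool ((None, Some v) \<in> L\<^sup>*))"
  let ?is = "\<lambda>v. map snd (filter (\<lambda>(R, i). (None, Some v) \<in> R) (Q (rd v)))"
  let ?f = "\<lambda>v F. do {P \<leftarrow> sum_gates (?is v); emit (Add F P)}"
  define I where "I vs F c' \<longleftrightarrow> F < length c' \<and> (\<forall>\<theta>. gate_value c' \<theta> F = (\<Sum>v\<leftarrow>vs. ?pr \<theta> v))"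
    for vs F c'
  have "spec (\<Sum>v\<leftarrow>enum (pverts G). 2 + 2 ^ d\<^sup>2) (\<Sum>v\<leftarrow>enum (pverts G). 0)
    (foldM ?f (enum (pverts G)) F) (I (enum (pverts G))) c"
  proof (rule spec_foldM)
    fix us v vs F c'
    assume split: "enum (pverts G) = us @ v # vs" and c': "extends c c'" and F: "I us F c'"
    have "v \<in> set (enum (pverts G))"
      unfolding split by simp
    then have v: "rd v \<in> set (nodes t)" "v \<in> B (rd v)"
      using enum(2)[OF pair_finite_verts] readout by (auto simp: readout_assignment_def)
    have br: "branch c' (rd v) (set (nodes t)) (Q (rd v))"
      using branch_extends[OF Q[OF v(1)] c'] .
    then obtain Y where Y: "Y \<subseteq> bag (rd v)" "dist_ok Y c' (Q (rd v))"
      by (auto elim!: branchE simp: law_def)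
    have "finite Y" "card Y \<le> d"
      using Y(1) finite_bag[OF v(1)] card_bag[OF v(1)] by (auto intro: finite_subset
        order_trans[OF card_mono])
    then have len: "length (?is v) \<le> 2 ^ d\<^sup>2"
      using dist_ok_length[OF Y(2)] order_trans[OF length_filter_le] by fastforce
    have idx: "set (?is v) \<subseteq> {..<length c'}"
      using Y(2) unfolding dist_ok_def by auto
    have "spec ((1 + length (?is v)) + 1) (0 + 0) (?f v F) (I (us @ [v])) c'"
    proof (rule spec_bind[OF spec_sum_gates[OF extends_wf[OF c'] idx]], goal_cases)
      case (1 P c1)
      have F1: "F < length c1" "gate_value c1 \<theta> F = gate_value c' \<theta> F" for \<theta>
        using F 1(1) extends_length extends_gate_value unfolding I_def by blast+
      have P: "P < length c1" "gate_value c1 \<theta> P = ?pr \<theta> v" for \<theta>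
        using 1(2) reach_probability[OF br v(2)] by simp_all
      show ?case
      proof (rule spec_weaken[OF spec_emit[OF extends_wf[OF 1(1)]]])
        show "operands (Add F P) \<subseteq> {..<length c1}"
          using F1 P by simp
        show "I (us @ [v]) r c2" if "r = length c1 \<and> c2 = c1 @ [Add F P]" for r c2
          using that F F1 P by (simp add: I_def del: forward_snoc)
      qed auto
    qed
    then show "spec (2 + 2 ^ d\<^sup>2) 0 (?f v F) (I (us @ [v])) c'"
      using len by (elim spec_weaken) auto
  qed (use assms in \<open>auto simp: I_def\<close>)
  moreover have "(\<Sum>v\<leftarrow>enum (pverts G). ?pr \<theta> v) = extended_influence G p \<theta>" for \<theta>
  proof -
    have "(\<Sum>v\<leftarrow>enum (pverts G). ?pr \<theta> v) = (\<Sum>v\<in>pverts G. ?pr \<theta> v)"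
      using enum[OF pair_finite_verts] by (simp add: sum_list_distinct_conv_sum_set)
    also have "\<dots> = extended_influence G p \<theta>"
      unfolding extended_influence_def reach_count_def[abs_def] by (rule expect_sum[symmetric])
    finally show ?thesis .
  qed
  ultimately show ?thesis
    using length_enum[OF pair_finite_verts]
    by (elim spec_weaken) (auto simp: I_def sum_list_triv)
qed

lemma spec_compile:
  "spec compile_gates compile_ops (compile G p t B own rd)
    (\<lambda>out c. out < length c \<and> (\<forall>\<theta>. gate_value c \<theta> out = extended_influence G p \<theta>)) []"
  unfolding compile_def compile_gates_def compile_ops_def
proof (rule spec_bind)
  let ?I = "\<lambda>xs L c. \<forall>x\<in>set xs. branch c x {x} (L x)"
  let ?f = "\<lambda>x L. do {D \<leftarrow> local_dist G p B own x; State_Monad.return (L(x := D))}"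
  show "spec (\<Sum>x\<leftarrow>nodes t. local_gates) (\<Sum>x\<leftarrow>nodes t. local_ops)
    (foldM ?f (nodes t) (\<lambda>_. [])) (?I (nodes t)) []"
  proof (rule spec_foldM)
    fix ys x zs L c
    assume nodes: "nodes t = ys @ x # zs" and c: "extends [] c" and I: "?I ys L c"
    have x: "x \<in> set (nodes t)"
      unfolding nodes by simp
    have "spec (local_gates + 0) (local_ops + 0) (?f x L) (?I (ys @ [x])) c"
    proof (rule spec_bind[OF spec_local_dist[OF extends_wf[OF c] x]])
      fix D c' assume c': "extends c c'" and D: "branch c' x {x} D"
      then show "spec 0 0 (State_Monad.return (L(x := D))) (?I (ys @ [x])) c'"
        using I branch_extends[OF _ c'] by (intro spec_return) (auto intro: extends_wf)
    qed
    then show "spec local_gates local_ops (?f x L) (?I (ys @ [x])) c"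
      by simp
  qed auto
next
  fix L c1 assume c1: "extends [] c1" and L: "\<forall>x\<in>set (nodes t). branch c1 x {x} (L x)"
  then have L1: "\<And>x. x \<in> set (nodes t) \<Longrightarrow> branch c1 x {x} (L x)" by blast
  show "spec ((\<Sum>(y, x)\<leftarrow>rev (tree_arcs t). length (children t x) * combine_gates d + (1 + combine_gates d)) +
     ((\<Sum>x\<leftarrow>nodes t. down_gates x) + (1 + card (pverts G) * (2 + 2 ^ d\<^sup>2))))
    ((\<Sum>(y, x)\<leftarrow>rev (tree_arcs t). length (children t x) * combine_ops d + (0 + combine_ops d)) +
     ((\<Sum>x\<leftarrow>nodes t. down_ops x) + 0))
    (do {
      M \<leftarrow> upward t B L (\<lambda>_. []);
      (M', Q) \<leftarrow> downward t B L M;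
      F \<leftarrow> emit (Con 0);
      foldM (\<lambda>v F. do {
        P \<leftarrow> sum_gates (map snd (filter (\<lambda>(R, i). (None, Some v) \<in> R) (Q (rd v))));
        emit (Add F P)
      }) (enum (pverts G)) F
    }) (\<lambda>out c. out < length c \<and> (\<forall>\<theta>. gate_value c \<theta> out = extended_influence G p \<theta>)) c1"
  proof (rule spec_bind[OF spec_upward[OF extends_wf[OF c1] L1]], assumption, goal_cases)
    case (1 M c2)
    have L2: "branch c2 x {x} (L x)" if "x \<in> set (nodes t)" for x
      using branch_extends[OF L1[OF that] 1(1)] .
    have up: "branch c2 y (subtree t x) (M (x, y))" if "(y, x) \<in> set (tree_arcs t)" for x y
      using 1(2) that by blast
    show ?case
    proof (rule spec_bind[OF spec_downward[OF extends_wf[OF 1(1)] L2 up]], assumption, assumption, goal_cases)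
      case (1 r c3)
      obtain M' Q where r: "r = (M', Q)" by (cases r)
      have c3: "extends c2 c3" and Q: "\<And>x. x \<in> set (nodes t) \<Longrightarrow> branch c3 x (set (nodes t)) (Q x)"
        using 1 unfolding r by auto
      have "spec (1 + card (pverts G) * (2 + 2 ^ d\<^sup>2)) (0 + 0)
        (do {
          F \<leftarrow> emit (Con 0);
          foldM (\<lambda>v F. do {
            P \<leftarrow> sum_gates (map snd (filter (\<lambda>(R, i). (None, Some v) \<in> R) (Q (rd v))));
            emit (Add F P)
          }) (enum (pverts G)) F
        }) (\<lambda>out c. out < length c \<and> (\<forall>\<theta>. gate_value c \<theta> out = extended_influence G p \<theta>)) c3"
      proof (rule spec_bind[OF spec_emit], goal_cases)
        case (3 F c4)
        then show ?case
          using branch_extends[OF Q] extends_wf[OF 3(1)]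
          by (intro spec_readout) (auto simp del: forward_snoc)
      qed (use c3 extends_wf in auto)
      then show ?case
        unfolding r by simp
    qed
  qed
qed

section \<open>The number of operations\<close>

lemma sum_children_le:
  "(\<Sum>x\<leftarrow>nodes t. length (children t x) * a + b) \<le> length (nodes t) * (a + b)"
proof -
  have "(\<Sum>x\<leftarrow>nodes t. length (children t x) * a + b) = length (tree_arcs t) * a + length (nodes t) * b"
    using sum_length_children[OF distinct_nodes]
    by (simp add: sum_list_addf sum_list_triv sum_list_mult_const)
  then show ?thesis
    using length_tree_arcs[of t] by (simp add: algebra_simps mult_le_mono)
qed

lemma sum_arcs_le:
  "(\<Sum>(y, x)\<leftarrow>rev (tree_arcs t). length (children t x) * a + b) \<le> length (nodes t) * (a + b)"
proof -
  have "(\<Sum>(y, x)\<leftarrow>rev (tree_arcs t). length (children t x) * a + b) =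
      (\<Sum>x\<leftarrow>map snd (tree_arcs t). length (children t x) * a + b)"
    by (simp add: rev_map[symmetric] split_def comp_def)
  also have "\<dots> \<le> (\<Sum>x\<leftarrow>nodes t. length (children t x) * a + b)"
    unfolding nodes_conv_tree_arcs by simp
  finally show ?thesis
    using sum_children_le[of a b] by linarith
qed

text \<open>Amortized over the tree, a node pays for two combinations in the upward sweep and four
  in the downward sweep, and for one unit gate in each.\<close>

lemma compile_gates_le:
  "compile_gates \<le> length (nodes t) * (local_gates + 2 + 6 * combine_gates d) +
     (1 + card (pverts G) * (2 + 2 ^ d\<^sup>2))"
proof -
  have "(\<Sum>x\<leftarrow>nodes t. down_gates x) =
      (\<Sum>x\<leftarrow>nodes t. length (children t x) * (3 * combine_gates d) + (1 + combine_gates d))"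
    by (simp add: down_gates_def[abs_def] add_ac)
  then show ?thesis
    using sum_children_le[of "3 * combine_gates d" "1 + combine_gates d"]
      sum_arcs_le[of "combine_gates d" "1 + combine_gates d"]
    by (simp add: compile_gates_def sum_list_triv algebra_simps)
qed

lemma compile_ops_le:
  "compile_ops \<le> length (nodes t) * (local_ops + 6 * combine_ops d)"
proof -
  have "(\<Sum>x\<leftarrow>nodes t. down_ops x) =
      (\<Sum>x\<leftarrow>nodes t. length (children t x) * (3 * combine_ops d) + combine_ops d)"
    by (simp add: down_ops_def[abs_def] add_ac)
  then show ?thesis
    using sum_children_le[of "3 * combine_ops d" "combine_ops d"]
      sum_arcs_le[of "combine_ops d" "combine_ops d"]
    by (simp add: compile_ops_def sum_list_triv algebra_simps)
qed

lemma compile_gates_bound: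
  assumes "length (nodes t) \<le> b * n" "card (pverts G) = n" "1 \<le> n"
  shows "compile_gates \<le> n * (2 ^ d\<^sup>2 * 2 ^ d\<^sup>2) * (b * (15 + 7 * d\<^sup>2) + 4)"
proof -
  define N :: nat where "N = 2 ^ d\<^sup>2"
  have N: "1 \<le> N" "N \<le> N * N" "1 \<le> N * N"
    by (simp_all add: N_def)
  have cg: "combine_gates d = 2 * (N * N)"
    by (simp add: combine_gates_def N_def)
  have "local_gates + 2 + 6 * combine_gates d = 3 + 12 * (N * N) + d\<^sup>2 * (5 + 2 * (N * N))"
    by (simp add: local_gates_def cg)
  \<comment> \<open>Terms without the factor \<open>N * N\<close> are inflated by it, which gives
    \<open>15 = 3 + 12\<close> and \<open>7 = 5 + 2\<close>.\<close>
  also have "\<dots> \<le> 3 * (N * N) + 12 * (N * N) + d\<^sup>2 * (5 * (N * N) + 2 * (N * N))"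
    using N by (intro add_mono mult_le_mono) auto
  also have "\<dots> = N * N * (15 + 7 * d\<^sup>2)"
    by (simp add: algebra_simps)
  finally have "length (nodes t) * (local_gates + 2 + 6 * combine_gates d) \<le>
      (b * n) * (N * N * (15 + 7 * d\<^sup>2))"
    using assms(1) by (rule mult_le_mono[rotated])
  moreover have "1 + n * (2 + N) \<le> n * (4 * (N * N))"
  proof -
    have "1 + n * (2 + N) \<le> n * 1 + n * (2 + N)"
      using assms(3) by simp
    also have "\<dots> = n * (3 + N)"
      by (simp add: algebra_simps)
    also have "\<dots> \<le> n * (4 * (N * N))"
      by (rule mult_le_mono2) (use N in linarith)
    finally show ?thesis .
  qed
  ultimately have "compile_gates \<le> (b * n) * (N * N * (15 + 7 * d\<^sup>2)) + n * (4 * (N * N))"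
    using compile_gates_le unfolding assms(2) N_def[symmetric] by (meson add_mono le_trans)
  also have "\<dots> = n * (N * N) * (b * (15 + 7 * d\<^sup>2) + 4)"
    by (simp add: algebra_simps)
  finally show ?thesis
    by (simp add: N_def)
qed

lemma compile_ops_bound:
  assumes "length (nodes t) \<le> b * n"
  shows "compile_ops \<le> n * (2 ^ d\<^sup>2 * 2 ^ d\<^sup>2) * (b * (d ^ 3 * (d\<^sup>2 + 6)))"
proof -
  have "compile_ops \<le> (b * n) * (local_ops + 6 * combine_ops d)"
    using compile_ops_le assms by (meson le_trans mult_le_mono1)
  then show ?thesis
    by (simp add: local_ops_def combine_ops_def algebra_simps)
qed

section \<open>Correctness of Exact Greedy\<close>

lemma gradient_marginal_gain:
  assumes "wf_circuit c" "out < length c"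
    and "\<And>\<theta>. gate_value c \<theta> out = extended_influence G p \<theta>"
    and "\<And>e. e \<in> parcs G \<Longrightarrow> 0 \<le> p e \<and> p e \<le> 1"
    and "v \<in> pverts G - S"
  shows "fst (backward c out (gate_values c (indicat_real S))) v = marginal_gain G p v S"
proof -
  have fin: "pair_fin_digraph G"
    by unfold_locales
  have upd: "(indicat_real S)(v := 1) = indicat_real (S \<union> {v})" "(indicat_real S)(v := 0) = indicat_real S"
    using assms(5) by (auto simp: indicator_def fun_eq_iff)
  have "((\<lambda>s. gate_value c ((indicat_real S)(v := s)) out) has_real_derivative
      extended_influence G p ((indicat_real S)(v := 1)) -
      extended_influence G p ((indicat_real S)(v := 0))) (at (indicat_real S v))"
    unfolding assms(3) using assms(5) by (intro extended_influence_has_derivative[OF fin]) auto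
  then have "fst (backward c out (gate_values c (indicat_real S))) v =
      extended_influence G p ((indicat_real S)(v := 1)) -
      extended_influence G p ((indicat_real S)(v := 0))"
    by (rule backward_derivative[OF assms(1,2)])
  moreover have "extended_influence G p (indicat_real S') = influence G p S'" for S'
    using assms(4) by (intro extended_influence_indicator[OF fin])
  ultimately show ?thesis
    unfolding upd marginal_gain_def by simp
qed

end

text \<open>Agreement on the candidates suffices: the sets of maximizers coincide, and ties are
  resolved from \<open>S\<close> and that set alone. For vertices of \<open>S\<close> the gradient
  is in general not the marginal gain.\<close>

lemma select_cong:
  "(\<And>v. v \<in> pverts G - S \<Longrightarrow> f v = g v) \<Longrightarrow> select tie G S f = select tie G S g"
  unfolding select_def is_arg_max_def by (intro arg_cong[where f = "tie S"] Collect_cong) auto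

text \<open>Per gate, one operation forward and at most four backward; per candidate, two
  comparisons.\<close>

lemma exact_greedy_rounds:
  assumes "finite (pverts G)"
    and "\<And>S v. v \<in> pverts G - S \<Longrightarrow>
      fst (backward c out (gate_values c (indicat_real S))) v = marginal_gain G p v S"
  shows "fst ((exact_greedy_round tie G c out ^^ K) ({}, 0)) = classical_greedy tie G p K \<and>
    snd ((exact_greedy_round tie G c out ^^ K) ({}, 0)) \<le> K * (5 * length c + 2 * card (pverts G))"
proof (induction K)
  case 0
  then show ?case by (simp add: classical_greedy_def)
next
  case (Suc K)
  obtain S k where Sk: "(exact_greedy_round tie G c out ^^ K) ({}, 0) = (S, k)"
    by (metis prod.exhaust)
  obtain vs k1 where vs: "forward c (indicat_real S) = (vs, k1)"
    by (metis prod.exhaust)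
  obtain g k2 where g: "backward c out vs = (g, k2)"
    by (metis prod.exhaust)
  have "k1 \<le> length c"
    using forward_cost[of c "indicat_real S"] vs by simp
  moreover have "k2 \<le> 4 * length c"
    using backward_cost[of c out vs] g by simp
  moreover have "card (pverts G - S) \<le> card (pverts G)"
    using assms(1) by (intro card_mono) auto
  moreover have "select tie G S g = select tie G S (\<lambda>v. marginal_gain G p v S)"
    using assms(2)[of _ S] vs g by (intro select_cong) simp
  ultimately show ?case
    using Suc Sk vs g by (simp add: exact_greedy_round_def classical_greedy_def)
qed

theorem theorem5p1:
  fixes b :: nat
  shows "\<exists>(c :: nat) (q :: nat poly).
    \<forall>(G :: 'a pair_pre_digraph) (p :: 'a \<times> 'a \<Rightarrow> real) (t :: 'b rtree) (B :: 'b \<Rightarrow> 'a set)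
       (own :: 'a option \<times> 'a option \<Rightarrow> 'b) (rd :: 'a \<Rightarrow> 'b) (tie :: 'a set \<Rightarrow> 'a set \<Rightarrow> 'a)
       (n :: nat) (w :: nat) (K :: nat) (S :: 'a set) (ops :: nat) (prep :: nat).
      pair_digraph G \<and> card (pverts G) = n \<and>
      (\<forall>e\<in>parcs G. 0 \<le> p e \<and> p e \<le> 1) \<and>
      tree_decomposition G t B \<and> width t B = w \<and> length (nodes t) \<le> b * n \<and>
      K \<le> n \<and>
      owner_assignment G t B own \<and> readout_assignment G t B rd \<and>
      (\<forall>S A. A \<noteq> {} \<longrightarrow> tie S A \<in> A) \<and>
      exact_greedy tie G p t B own rd K = (S, ops, prep)
      \<longrightarrow>
      S = classical_greedy tie G p K \<and>
      ops \<le> K * n * 2 ^ (c * w\<^sup>2) * poly q w \<and>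
      prep \<le> n * 2 ^ (c * w\<^sup>2) * poly q w"
proof -
  \<comment> \<open>The polynomial \<open>w + 2\<close>, the size bound of an extended bag: at most
    \<open>w + 1\<close> original vertices and \<open>None\<close>.\<close>
  define D :: "nat poly" where "D = [:2, 1:]"
  \<comment> \<open>The factor 256 is \<open>2 ^ 8\<close>: a pair of states contributes
    \<open>2 ^ (2 * (w + 2)\<^sup>2)\<close>, and
    \<open>2 * (w + 2)\<^sup>2 \<le> 8 + 10 * w\<^sup>2\<close> because
    \<open>w \<le> w\<^sup>2\<close> for naturals. This is also the origin of the exponent constant
    10.\<close>
  define gates where "gates w = 256 * (b * (15 + 7 * (w + 2)\<^sup>2) + 4)" for w
  define rels where "rels w = 256 * (b * ((w + 2) ^ 3 * ((w + 2)\<^sup>2 + 6)))" for w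
  \<comment> \<open>One polynomial serves both bounds: \<open>5 * gates w\<close> for the two
    passes, 2 for the comparisons, \<open>rels w\<close> for the preprocessing.\<close>
  define q :: "nat poly" where
    "q = [:5 * 256:] * ([:b:] * ([:15:] + [:7:] * D\<^sup>2) + [:4:]) + [:2:]
       + [:256:] * ([:b:] * (D ^ 3 * (D\<^sup>2 + [:6:])))"
  have q: "poly q w = 5 * gates w + 2 + rels w" for w
    by (simp add: q_def D_def gates_def rels_def add.commute[of _ 2])
  show ?thesis
  proof (rule exI[of _ 10], rule exI[of _ q], intro allI impI, elim conjE)
    fix G :: "'a pair_pre_digraph" and p :: "'a \<times> 'a \<Rightarrow> real" and t :: "'b rtree"
      and B :: "'b \<Rightarrow> 'a set" and own rd and tie :: "'a set \<Rightarrow> 'a set \<Rightarrow> 'a"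
      and n w K S ops prep
    assume G: "pair_digraph G" and n: "card (pverts G) = n"
      and p: "\<forall>e\<in>parcs G. 0 \<le> p e \<and> p e \<le> 1"
      and td: "tree_decomposition G t B" and w: "width t B = w" and bn: "length (nodes t) \<le> b * n"
      and own: "owner_assignment G t B own" and rd: "readout_assignment G t B rd"
      and run: "exact_greedy tie G p t B own rd K = (S, ops, prep)"
    interpret pair_fin_digraph G
      using G by (simp add: pair_digraph_def)
    interpret decomposed_graph G p t B own rd "w + 2"
    proof
      fix x assume "x \<in> set (nodes t)"
      then have "card (B x) \<le> Max ((\<lambda>x. card (B x)) ` set (nodes t))"
        by (intro Max_ge) auto
      \<comment> \<open>The truncated subtraction in \<open>width\<close> does no harm: the maximal
        bag size is at most \<open>w + 1\<close> even if all bags are empty.\<close>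
      then show "card (B x) + 1 \<le> w + 2"
        using w by (simp add: width_def)
    qed (use td own rd in auto)
    \<comment> \<open>A tree has a root, so the bound \<open>b * n\<close> on its nodes forces
      \<open>n\<close> to be positive; this lets the additive constant in the gate count be absorbed
      into a multiple of \<open>n\<close>.\<close>
    have "length (nodes t) \<noteq> 0"
      by (cases t) simp
    then have "1 \<le> n"
      using bn by (cases n) auto
    obtain out c prep' where comp: "run_state (compile G p t B own rd) ([], 0) = (out, c, prep')"
      by (metis prod_cases3)
    then have c: "wf_circuit c" "length c \<le> compile_gates" "prep' \<le> compile_ops"
      and out: "out < length c" "\<And>\<theta>. gate_value c \<theta> out = extended_influence G p \<theta>"
      using spec_compile unfolding spec_def extends_def by fastforce+
    have S: "S = fst ((exact_greedy_round tie G c out ^^ K) ({}, 0))"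
      and ops: "ops = snd ((exact_greedy_round tie G c out ^^ K) ({}, 0))" and prep: "prep = prep'"
      using run comp by (auto simp: exact_greedy_def split: prod.splits)
    have rounds: "S = classical_greedy tie G p K" "ops \<le> K * (5 * length c + 2 * n)"
      using exact_greedy_rounds[OF pair_finite_verts gradient_marginal_gain[OF c(1) out], where K = K
          and tie = tie] p unfolding S ops n by blast+
    define E :: nat where "E = 2 ^ (10 * w\<^sup>2)"
    have "(2::nat) ^ (w + 2)\<^sup>2 * 2 ^ (w + 2)\<^sup>2 = 2 ^ (2 * (w + 2)\<^sup>2)"
      by (simp add: mult_2 power_add)
    also have "\<dots> \<le> 2 ^ (8 + 10 * w\<^sup>2)"
    proof (rule power_increasing)
      have "w \<le> w\<^sup>2" by (simp add: power2_nat_le_imp_le power2_eq_square)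
      then show "2 * (w + 2)\<^sup>2 \<le> 8 + 10 * w\<^sup>2"
        by (simp add: power2_eq_square algebra_simps)
    qed simp
    also have "\<dots> = 256 * E"
      by (simp add: E_def power_add)
    finally have states: "(2::nat) ^ (w + 2)\<^sup>2 * 2 ^ (w + 2)\<^sup>2 \<le> 256 * E" .
    have "length c \<le> n * (256 * E) * (b * (15 + 7 * (w + 2)\<^sup>2) + 4)"
      using c(2) compile_gates_bound[OF bn n \<open>1 \<le> n\<close>] states
      by (meson le_trans mult_le_mono1 mult_le_mono2)
    then have "length c \<le> n * E * gates w"
      by (simp add: gates_def algebra_simps)
    moreover have "n \<le> n * E"
      by (simp add: E_def)
    ultimately have "5 * length c + 2 * n \<le> 5 * (n * E * gates w) + 2 * (n * E)"
      by linarith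
    also have "\<dots> \<le> n * E * poly q w"
      by (simp add: q algebra_simps)
    finally have "K * (5 * length c + 2 * n) \<le> K * (n * E * poly q w)"
      by (rule mult_le_mono2)
    with rounds(2) have "ops \<le> K * (n * E * poly q w)"
      by (rule order_trans)
    then have ops_le: "ops \<le> K * n * E * poly q w"
      by (simp add: mult.assoc)
    have "prep \<le> n * (256 * E) * (b * ((w + 2) ^ 3 * ((w + 2)\<^sup>2 + 6)))"
      using c(3) compile_ops_bound[OF bn] states unfolding prep
      by (meson le_trans mult_le_mono1 mult_le_mono2)
    then have "prep \<le> n * E * rels w"
      by (simp add: rels_def algebra_simps)
    moreover have "n * E * rels w \<le> n * E * poly q w"
      by (rule mult_le_mono2) (simp add: q)
    ultimately have "prep \<le> n * E * poly q w"
      by (rule order_trans)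
    with ops_le show "S = classical_greedy tie G p K \<and>
      ops \<le> K * n * 2 ^ (10 * w\<^sup>2) * poly q w \<and> prep \<le> n * 2 ^ (10 * w\<^sup>2) * poly q w"
      using rounds(1) by (simp add: E_def)
  qed
qed

end
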